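(* Let $r,s\in\mathbb{C}^*$ be roots of unity with $r^2\neq s^2$, let $\lambda\in\mathbb{C}^*$ and $m=\operatorname{ord}(rs^{-1})$. Then: (1) The $U^+_{r,s}(B_2)$-module $Q_{1,m}$ is simple and is isomorphic to the simple module $\mathcal{M}(\xi)$ with $\xi_1=\lambda$ and $\xi_2=0$. (2) For each $k\ge2$, $Q_{k,m}$ is an indecomposable but not simple $U^+_{r,s}(B_2)$-module.
   Context: $U^+_{r,s}(B_2)$ is the unital associative $\mathbb{C}$-algebra generated by $e_1,e_2$ subject to $$e_1^2 e_2-(r^2+s^2)e_1e_2e_1+r^2s^2e_2e_1^2=0,$$ $$e_1e_2^3-(r^2+rs+s^2)e_2e_1e_2^2+rs(r^2+rs+s^2)e_2^2e_1e_2-r^3s^3e_2^3e_1=0.$$ Put $X_1=e_1$, $X_2=e_1e_2-r^2e_2e_1$, $X_3=e_2X_2-s^{-2}X_2e_2$, $X_4=e_2$. These satisfy $$X_1X_2=s^2X_2X_1,\quad X_1X_3=r^2s^2X_3X_1,\quad X_1X_4=r^2X_4X_1+X_2,$$ $$X_2X_3=rsX_3X_2,\quad X_2X_4=s^2X_4X_2-s^2X_3,\quad X_3X_4=rsX_4X_3,$$ and the monomials $X_1^aX_2^bX_3^cX_4^d$ form a basis. All modules are right modules; $\operatorname{ord}(z)$ is the multiplicative order of $z$. Let $B$ be the subalgebra generated by $X_1,X_2,X_3$, and $\mathbb{C}_\lambda=\mathbb{C}v$ the one-dimensional $B$-module with $vX_1=vX_2=0$, $vX_3=\lambda v$. Let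 $M(\lambda)=\mathbb{C}_\lambda\otimes_BU^+_{r,s}(B_2)$, which has basis $f(k)=v\otimes X_4^k$, $k\ge0$, and action $$f(k)X_1=-\lambda r^{-2k}r^2\frac{((rs^{-1})^k-1)((rs^{-1})^{k-1}-1)}{((rs^{-1})^2-1)(rs^{-1}-1)}f(k-2)\ (k\ge2),\qquad f(0)X_1=f(1)X_1=0,$$ $$f(k)X_2=\lambda(rs)^{-(k-1)}\frac{1-(rs^{-1})^k}{1-rs^{-1}}f(k-1)\ (k\ge1),\qquad f(0)X_2=0,$$ $$f(k)X_3=\lambda(rs)^{-k}f(k),\qquad f(k)X_4=f(k+1).$$ For $k\ge0$, $M_{k,m}=\operatorname{span}_{\mathbb{C}}\{f(km+i):i\ge0\}$, a submodule of $M(\lambda)$, and $Q_{k,m}=M_{0,m}/M_{k,m}$ (of dimension $km$). For $\xi=(\xi_1,0)$ with $\xi_1\in\mathbb{C}^*$, $\mathcal{M}(\xi)$ is the $U^+_{r,s}(B_2)$-module with basis $\{e(a):0\le a\le m-1\}$ and action $$e(a)X_1=-r^{-2(a-1)}\frac{1-(rs^{-1})^{a-1}}{1-rs^{-1}}\frac{1-(rs^{-1})^a}{1-(rs^{-1})^2}\xi_1e(a-2)\ (a\ge2),\qquad e(0)X_1=e(1)X_1=0,$$ $$e(a)X_2=(rs)^{-(a-1)}\frac{1-(rs^{-1})^a}{1-rs^{-1}}\xi_1e(a-1)\ (a\ge1),\qquad e(0)X_2=0,$$ $$e(a)X_3=(rs)^{-a}\xi_1e(a),\qquad e(a)X_4=e(a+1)\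 (a\le m-2),\qquad e(m-1)X_4=0.$$ *)

theory Defs
  imports Complex_Main "HOL-Library.Poly_Mapping" "HOL-Algebra.QuotRing"
    "HOL-Algebra.Generated_Rings" "HOL-Algebra.Generated_Groups"
begin

section \<open>Right modules over a (not necessarily commutative) ring\<close>

text \<open>The multiplicative fields inherited from \<^type>\<open>ring\<close> are not used, as for the
  library's left modules over commutative rings.\<close>

record ('a, 'b) rmod = "'b ring" +
  ract :: "'b \<Rightarrow> 'a \<Rightarrow> 'b" (infixl \<open>\<lhd>\<index>\<close> 70)

locale right_module = R?: ring R + M?: abelian_group M
  for R :: "('a, 'm) ring_scheme" (structure)
    and M :: "('a, 'b, 'n) rmod_scheme" (structure) +
  assumes ract_closed:
      "\<lbrakk> x \<in> carrier M; a \<in> carrier R \<rbrakk> \<Longrightarrow> x \<lhd>\<^bsub>M\<^esub> a \<in> carrier M"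
    and ract_add_left:
      "\<lbrakk> x \<in> carrier M; y \<in> carrier M; a \<in> carrier R \<rbrakk> \<Longrightarrow>
        (x \<oplus>\<^bsub>M\<^esub> y) \<lhd>\<^bsub>M\<^esub> a = x \<lhd>\<^bsub>M\<^esub> a \<oplus>\<^bsub>M\<^esub> y \<lhd>\<^bsub>M\<^esub> a"
    and ract_add_right:
      "\<lbrakk> x \<in> carrier M; a \<in> carrier R; b \<in> carrier R \<rbrakk> \<Longrightarrow>
        x \<lhd>\<^bsub>M\<^esub> (a \<oplus>\<^bsub>R\<^esub> b) = x \<lhd>\<^bsub>M\<^esub> a \<oplus>\<^bsub>M\<^esub> x \<lhd>\<^bsub>M\<^esub> b"
    and ract_assoc:
      "\<lbrakk> x \<in> carrier M; a \<in> carrier R; b \<in> carrier R \<rbrakk> \<Longrightarrow>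
        x \<lhd>\<^bsub>M\<^esub> (a \<otimes>\<^bsub>R\<^esub> b) = (x \<lhd>\<^bsub>M\<^esub> a) \<lhd>\<^bsub>M\<^esub> b"
    and ract_one: "x \<in> carrier M \<Longrightarrow> x \<lhd>\<^bsub>M\<^esub> \<one>\<^bsub>R\<^esub> = x"

definition rsubmodule :: "'b set \<Rightarrow> ('a, 'm) ring_scheme \<Rightarrow> ('a, 'b, 'n) rmod_scheme \<Rightarrow> bool" where
  "rsubmodule H R M \<longleftrightarrow> additive_subgroup H M \<and>
     (\<forall>x\<in>H. \<forall>a\<in>carrier R. x \<lhd>\<^bsub>M\<^esub> a \<in> H)"

definition quot_rmod :: "('a, 'b, 'n) rmod_scheme \<Rightarrow> 'b set \<Rightarrow> ('a, 'b set) rmod" where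
  "quot_rmod M H = \<lparr>carrier = a_rcosets\<^bsub>M\<^esub> H, monoid.mult = undefined, one = undefined,
     zero = H, add = set_add M,
     ract = (\<lambda>X a. \<Union>x\<in>X. H +>\<^bsub>M\<^esub> (x \<lhd>\<^bsub>M\<^esub> a))\<rparr>"

definition simple_rmod :: "('a, 'm) ring_scheme \<Rightarrow> ('a, 'b, 'n) rmod_scheme \<Rightarrow> bool" where
  "simple_rmod R M \<longleftrightarrow> right_module R M \<and> carrier M \<noteq> {\<zero>\<^bsub>M\<^esub>} \<and>
     (\<forall>H. rsubmodule H R M \<longrightarrow> H = {\<zero>\<^bsub>M\<^esub>} \<or> H = carrier M)"

definition indecomposable_rmod :: "('a, 'm) ring_scheme \<Rightarrow> ('a, 'b, 'n) rmod_scheme \<Rightarrow> bool" where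
  "indecomposable_rmod R M \<longleftrightarrow> right_module R M \<and> carrier M \<noteq> {\<zero>\<^bsub>M\<^esub>} \<and>
     \<not> (\<exists>H K. rsubmodule H R M \<and> rsubmodule K R M \<and>
           H \<noteq> {\<zero>\<^bsub>M\<^esub>} \<and> K \<noteq> {\<zero>\<^bsub>M\<^esub>} \<and>
           H \<inter> K = {\<zero>\<^bsub>M\<^esub>} \<and> H <+>\<^bsub>M\<^esub> K = carrier M)"

definition rmod_isomorphic ::
  "('a, 'm) ring_scheme \<Rightarrow> ('a, 'b, 'n) rmod_scheme \<Rightarrow> ('a, 'c, 'k) rmod_scheme \<Rightarrow> bool" where
  "rmod_isomorphic R M N \<longleftrightarrow> (\<exists>h. bij_betw h (carrier M) (carrier N) \<and>
     (\<forall>x\<in>carrier M. \<forall>y\<in>carrier M. h (x \<oplus>\<^bsub>M\<^esub> y) = h x \<oplus>\<^bsub>N\<^esub> h y) \<and>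
     (\<forall>x\<in>carrier M. \<forall>a\<in>carrier R. h (x \<lhd>\<^bsub>M\<^esub> a) = h x \<lhd>\<^bsub>N\<^esub> a))"

section \<open>Induction of a right module along a subring\<close>

text \<open>For a subring \<open>B\<close> of \<open>S\<close> and a right \<open>B\<close>-module \<open>C\<close>, the tensor product of \<open>C\<close> and
  \<open>S\<close> over \<open>B\<close> is the free abelian group on the pairs \<open>(x, u)\<close> modulo biadditivity and
  balancedness. The free abelian group carries the operation \<open>(x, u) \<lhd> w = (x, u w)\<close>, which is
  not additive in \<open>w\<close>; it becomes a module only after passing to the quotient.\<close>

definition free_pairs :: "('a, 'm) ring_scheme \<Rightarrow> ('a, 'b, 'n) rmod_scheme \<Rightarrow>
    ('a, ('b \<times> 'a \<Rightarrow>\<^sub>0 int)) rmod" where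
  "free_pairs S C = \<lparr>carrier = {p. Poly_Mapping.keys p \<subseteq> carrier C \<times> carrier S},
     monoid.mult = undefined, one = undefined, zero = 0, add = (+),
     ract = (\<lambda>p w. frag_extend (\<lambda>(x, u). frag_of (x, u \<otimes>\<^bsub>S\<^esub> w)) p)\<rparr>"

definition tensor_relations :: "('a, 'k) ring_scheme \<Rightarrow> ('a, 'm) ring_scheme \<Rightarrow>
    ('a, 'b, 'n) rmod_scheme \<Rightarrow> ('b \<times> 'a \<Rightarrow>\<^sub>0 int) set" where
  "tensor_relations B S C =
     {frag_of (x \<oplus>\<^bsub>C\<^esub> y, u) - frag_of (x, u) - frag_of (y, u) | x y u.
        x \<in> carrier C \<and> y \<in> carrier C \<and> u \<in> carrier S} \<union>
     {frag_of (x, u \<oplus>\<^bsub>S\<^esub> w) - frag_of (x, u) - frag_of (x, w) | x u w.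
        x \<in> carrier C \<and> u \<in> carrier S \<and> w \<in> carrier S} \<union>
     {frag_of (x \<lhd>\<^bsub>C\<^esub> b, u) - frag_of (x, b \<otimes>\<^bsub>S\<^esub> u) | x b u.
        x \<in> carrier C \<and> b \<in> carrier B \<and> u \<in> carrier S}"

definition tensor_kernel :: "('a, 'k) ring_scheme \<Rightarrow> ('a, 'm) ring_scheme \<Rightarrow>
    ('a, 'b, 'n) rmod_scheme \<Rightarrow> ('b \<times> 'a \<Rightarrow>\<^sub>0 int) set" where
  "tensor_kernel B S C = generate (add_monoid (free_pairs S C)) (tensor_relations B S C)"

definition induced_rmod :: "('a, 'k) ring_scheme \<Rightarrow> ('a, 'm) ring_scheme \<Rightarrow>
    ('a, 'b, 'n) rmod_scheme \<Rightarrow> ('a, ('b \<times> 'a \<Rightarrow>\<^sub>0 int) set) rmod" where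
  "induced_rmod B S C = quot_rmod (free_pairs S C) (tensor_kernel B S C)"

definition pure_tensor :: "('a, 'k) ring_scheme \<Rightarrow> ('a, 'm) ring_scheme \<Rightarrow>
    ('a, 'b, 'n) rmod_scheme \<Rightarrow> 'b \<Rightarrow> 'a \<Rightarrow> ('b \<times> 'a \<Rightarrow>\<^sub>0 int) set" where
  "pure_tensor B S C x u = tensor_kernel B S C +>\<^bsub>free_pairs S C\<^esub> frag_of (x, u)"

section \<open>The algebra \<open>U\<close>\<close>

datatype gen = E1 | E2

text \<open>The free monoid on \<^term>\<open>E1\<close>, \<^term>\<open>E2\<close>, written additively so that
  \<open>word \<Rightarrow>\<^sub>0 complex\<close> with its convolution product is the free algebra on two generators.\<close>

datatype word = Word "gen list"

instantiation word :: monoid_add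
begin
definition zero_word :: word where "zero_word = Word []"
fun plus_word :: "word \<Rightarrow> word \<Rightarrow> word" where "plus_word (Word v) (Word w) = Word (v @ w)"
instance
proof
  fix a b c :: word
  show "a + b + c = a + (b + c)" by (cases a; cases b; cases c) simp
  show "0 + a = a" by (cases a) (simp add: zero_word_def)
  show "a + 0 = a" by (cases a) (simp add: zero_word_def)
qed
end

type_synonym free_alg = "word \<Rightarrow>\<^sub>0 complex"

definition fscalar :: "complex \<Rightarrow> free_alg" where
  "fscalar c = Poly_Mapping.single 0 c"

definition fgen :: "gen \<Rightarrow> free_alg" where
  "fgen g = Poly_Mapping.single (Word [g]) 1"

definition free_ring :: "free_alg ring" where
  "free_ring = \<lparr>carrier = UNIV, monoid.mult = (*), one = 1, zero = 0, add = (+)\<rparr>"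

definition U_relations :: "complex \<Rightarrow> complex \<Rightarrow> free_alg set" where
  "U_relations r s = (let e1 = fgen E1; e2 = fgen E2 in
     {e1^2 * e2 - fscalar (r^2 + s^2) * e1 * e2 * e1 + fscalar (r^2 * s^2) * e2 * e1^2,
      e1 * e2^3 - fscalar (r^2 + r*s + s^2) * e2 * e1 * e2^2
        + fscalar (r * s * (r^2 + r*s + s^2)) * e2^2 * e1 * e2
        - fscalar (r^3 * s^3) * e2^3 * e1})"

definition U_ideal :: "complex \<Rightarrow> complex \<Rightarrow> free_alg set" where
  "U_ideal r s = Idl\<^bsub>free_ring\<^esub> (U_relations r s)"

definition U :: "complex \<Rightarrow> complex \<Rightarrow> free_alg set ring" where
  "U r s = free_ring Quot U_ideal r s"

definition U_class :: "complex \<Rightarrow> complex \<Rightarrow> free_alg \<Rightarrow> free_alg set" where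
  "U_class r s p = U_ideal r s +>\<^bsub>free_ring\<^esub> p"

text \<open>\<open>U\<close> is a complex algebra through this central ring homomorphism; every right \<open>U\<close>-module
  is a complex vector space by restriction along it.\<close>

definition U_scalar :: "complex \<Rightarrow> complex \<Rightarrow> complex \<Rightarrow> free_alg set" where
  "U_scalar r s c = U_class r s (fscalar c)"

definition FX1 :: free_alg where "FX1 = fgen E1"
definition FX4 :: free_alg where "FX4 = fgen E2"
definition FX2 :: "complex \<Rightarrow> free_alg" where
  "FX2 r = fgen E1 * fgen E2 - fscalar (r^2) * fgen E2 * fgen E1"
definition FX3 :: "complex \<Rightarrow> complex \<Rightarrow> free_alg" where
  "FX3 r s = fgen E2 * FX2 r - fscalar (1 / s^2) * FX2 r * fgen E2"

definition X1 :: "complex \<Rightarrow> complex \<Rightarrow> free_alg set" where "X1 r s = U_class r s FX1"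
definition X2 :: "complex \<Rightarrow> complex \<Rightarrow> free_alg set" where "X2 r s = U_class r s (FX2 r)"
definition X3 :: "complex \<Rightarrow> complex \<Rightarrow> free_alg set" where "X3 r s = U_class r s (FX3 r s)"
definition X4 :: "complex \<Rightarrow> complex \<Rightarrow> free_alg set" where "X4 r s = U_class r s FX4"

definition U_B :: "complex \<Rightarrow> complex \<Rightarrow> free_alg set ring" where
  "U_B r s = (U r s)\<lparr>carrier :=
     generate_ring (U r s) (range (U_scalar r s) \<union> {X1 r s, X2 r s, X3 r s})\<rparr>"

definition cspan :: "complex \<Rightarrow> complex \<Rightarrow> (free_alg set, 'b, 'n) rmod_scheme \<Rightarrow> 'b set \<Rightarrow> 'b set" where
  "cspan r s M A = generate (add_monoid M) {x \<lhd>\<^bsub>M\<^esub> U_scalar r s c | x c. x \<in> A}"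

section \<open>The modules\<close>

text \<open>The vector space of the one-dimensional module is the complex numbers with \<open>v = 1\<close>.
  The conditions determine the action on \<^term>\<open>carrier (U_B r s)\<close> uniquely, because \<open>B\<close> is
  generated by the elements they mention; the choice operator only leaves it arbitrary
  off the carrier.\<close>

definition complex_rmod :: "(complex \<Rightarrow> 'a \<Rightarrow> complex) \<Rightarrow> ('a, complex) rmod" where
  "complex_rmod act = \<lparr>carrier = UNIV, monoid.mult = undefined, one = undefined,
     zero = 0, add = (+), ract = act\<rparr>"

definition C_mod :: "complex \<Rightarrow> complex \<Rightarrow> complex \<Rightarrow> (free_alg set, complex) rmod" where
  "C_mod r s lam = complex_rmod (SOME act. right_module (U_B r s) (complex_rmod act) \<and>
     (\<forall>z c. act z (U_scalar r s c) = c * z) \<and>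
     act 1 (X1 r s) = 0 \<and> act 1 (X2 r s) = 0 \<and> act 1 (X3 r s) = lam)"

definition M_mod :: "complex \<Rightarrow> complex \<Rightarrow> complex \<Rightarrow>
    (free_alg set, (complex \<times> free_alg set \<Rightarrow>\<^sub>0 int) set) rmod" where
  "M_mod r s lam = induced_rmod (U_B r s) (U r s) (C_mod r s lam)"

definition f_vec :: "complex \<Rightarrow> complex \<Rightarrow> complex \<Rightarrow> nat \<Rightarrow> (complex \<times> free_alg set \<Rightarrow>\<^sub>0 int) set" where
  "f_vec r s lam k =
     pure_tensor (U_B r s) (U r s) (C_mod r s lam) 1 (X4 r s [^]\<^bsub>U r s\<^esub> k)"

definition M_sub :: "complex \<Rightarrow> complex \<Rightarrow> complex \<Rightarrow> nat \<Rightarrow> nat \<Rightarrow>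
    (complex \<times> free_alg set \<Rightarrow>\<^sub>0 int) set set" where
  "M_sub r s lam k m = cspan r s (M_mod r s lam) {f_vec r s lam (k * m + i) | i. True}"

definition Q_mod :: "complex \<Rightarrow> complex \<Rightarrow> complex \<Rightarrow> nat \<Rightarrow> nat \<Rightarrow>
    (free_alg set, (complex \<times> free_alg set \<Rightarrow>\<^sub>0 int) set set) rmod" where
  "Q_mod r s lam k m =
     quot_rmod ((M_mod r s lam)\<lparr>carrier := M_sub r s lam 0 m\<rparr>) (M_sub r s lam k m)"

text \<open>The module \<open>\<M>(\<xi>)\<close> for \<open>\<xi> = (xi1, 0)\<close>: its vector space consists of the finitely supported
  functions with support in \<open>{..<m}\<close>, and \<open>e(a)\<close> is \<^term>\<open>Poly_Mapping.single a 1\<close>.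
  As for \<^const>\<open>C_mod\<close>, the conditions determine the action on the carriers uniquely.\<close>

definition vec_rmod :: "nat \<Rightarrow> ((nat \<Rightarrow>\<^sub>0 complex) \<Rightarrow> 'a \<Rightarrow> (nat \<Rightarrow>\<^sub>0 complex)) \<Rightarrow>
    ('a, nat \<Rightarrow>\<^sub>0 complex) rmod" where
  "vec_rmod m act = \<lparr>carrier = {x. Poly_Mapping.keys x \<subseteq> {..<m}},
     monoid.mult = undefined, one = undefined, zero = 0, add = (+), ract = act\<rparr>"

definition Mxi_mod :: "complex \<Rightarrow> complex \<Rightarrow> nat \<Rightarrow> complex \<Rightarrow>
    (free_alg set, nat \<Rightarrow>\<^sub>0 complex) rmod" where
  "Mxi_mod r s m xi1 = (let q = r * inverse s; e = (\<lambda>a. Poly_Mapping.single a (1::complex)) in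
     vec_rmod m (SOME act. right_module (U r s) (vec_rmod m act) \<and>
       (\<forall>a<m. \<forall>z c. act (Poly_Mapping.single a z) (U_scalar r s c) = Poly_Mapping.single a (c * z)) \<and>
       (\<forall>a<m. act (e a) (X1 r s) =
          (if a \<ge> 2 then Poly_Mapping.single (a - 2)
             (- (1 / r^(2 * (a - 1))) * ((1 - q^(a - 1)) / (1 - q)) * ((1 - q^a) / (1 - q^2)) * xi1)
           else 0)) \<and>
       (\<forall>a<m. act (e a) (X2 r s) =
          (if a \<ge> 1 then Poly_Mapping.single (a - 1)
             (1 / (r * s)^(a - 1) * ((1 - q^a) / (1 - q)) * xi1)
           else 0)) \<and>
       (\<forall>a<m. act (e a) (X3 r s) = Poly_Mapping.single a (1 / (r * s)^a * xi1)) \<and>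
       (\<forall>a<m. act (e a) (X4 r s) = (if Suc a < m then e (Suc a) else 0))))"

text \<open>The multiplicative order; it is 0 if \<open>z\<close> is not a root of unity.\<close>

definition mult_ord :: "complex \<Rightarrow> nat" where
  "mult_ord z = (if \<exists>n>0. z ^ n = 1 then LEAST n. n > 0 \<and> z ^ n = 1 else 0)"

end

theory Submission
  imports Defs
begin

text \<open>The formulas for the action on $f(k)$ define an action of the free algebra on the space $V$ of
  finitely supported sequences; it respects the relations, hence is an action of \<open>U\<close>. The line
  spanned by $f(0)$ is \<open>B\<close>-stable, which shows that the one-dimensional \<open>B\<close>-module exists
  and yields a homomorphism from the induced module to $V$. As \<open>U\<close> is the sum of the $B X_4^j$,
  it is an isomorphism, so that $Q_{k,m}$ is $V$ truncated at $N = km$.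

  A nonzero submodule of the truncation contains $f(N-1)$, as $X_4$ shifts the lowest term of a vector up
  to this position; hence two nonzero submodules always intersect. For $N = m$ the coefficients of $X_2$
  do not vanish, so that a nonzero submodule also contains $f(0)$, which generates everything. For
  $k \ge 2$ the vectors supported above $m$ form a proper submodule.\<close>

section \<open>Quotients and isomorphisms of right modules\<close>

text \<open>A character of \<open>B\<close> cannot simply be prescribed on \<open>X1\<close>,
  \<open>X2\<close>, \<open>X3\<close>: all relations holding in this subalgebra would have to be
  known, which amounts to a basis theorem. The model replaces it: its two operators are tested
  against the two relations of \<open>U\<close> only, and the character is then read off from f(0).
  The model also supplies linear independence, as rewriting shows only that the B X4^j span.

  Put q = r/s. Cutting at N = km is compatible with the action because, of the two generators, only
  \<open>X1\<close> lowers indices, and its weights across N contain the factor 1 - q^N.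

  The one-dimensional module and M(xi) are specified by a choice operator. Before anything can be
  computed in them, both existence (from the model) and uniqueness (from generators) have to be
  established.\<close>

definition rmod_iso :: "('a, 'm) ring_scheme \<Rightarrow> ('a, 'b, 'n) rmod_scheme \<Rightarrow> ('a, 'c, 'k) rmod_scheme \<Rightarrow>
    ('b \<Rightarrow> 'c) \<Rightarrow> bool" where
  "rmod_iso R M N h \<longleftrightarrow> bij_betw h (carrier M) (carrier N) \<and>
     (\<forall>x\<in>carrier M. \<forall>y\<in>carrier M. h (x \<oplus>\<^bsub>M\<^esub> y) = h x \<oplus>\<^bsub>N\<^esub> h y) \<and>
     (\<forall>x\<in>carrier M. \<forall>a\<in>carrier R. h (x \<lhd>\<^bsub>M\<^esub> a) = h x \<lhd>\<^bsub>N\<^esub> a)"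

lemma rmod_isomorphic_iff: "rmod_isomorphic R M N \<longleftrightarrow> (\<exists>h. rmod_iso R M N h)"
  by (simp add: rmod_isomorphic_def rmod_iso_def)

lemma rmod_isoD:
  assumes "rmod_iso R M N h"
  shows rmod_iso_bij: "bij_betw h (carrier M) (carrier N)"
    and rmod_iso_add: "\<And>x y. x \<in> carrier M \<Longrightarrow> y \<in> carrier M \<Longrightarrow> h (x \<oplus>\<^bsub>M\<^esub> y) = h x \<oplus>\<^bsub>N\<^esub> h y"
    and rmod_iso_act: "\<And>x a. x \<in> carrier M \<Longrightarrow> a \<in> carrier R \<Longrightarrow> h (x \<lhd>\<^bsub>M\<^esub> a) = h x \<lhd>\<^bsub>N\<^esub> a"
    and rmod_iso_closed: "\<And>x. x \<in> carrier M \<Longrightarrow> h x \<in> carrier N"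
    and rmod_iso_inj: "\<And>x y. x \<in> carrier M \<Longrightarrow> y \<in> carrier M \<Longrightarrow> h x = h y \<longleftrightarrow> x = y"
  using assms unfolding rmod_iso_def bij_betw_def inj_on_def by auto

lemma rmod_iso_zero:
  assumes "rmod_iso R M N h" "right_module R M" "right_module R N"
  shows "h \<zero>\<^bsub>M\<^esub> = \<zero>\<^bsub>N\<^esub>"
proof -
  interpret M: right_module R M by fact
  interpret N: right_module R N by fact
  have "h \<zero>\<^bsub>M\<^esub> \<oplus>\<^bsub>N\<^esub> h \<zero>\<^bsub>M\<^esub> = h \<zero>\<^bsub>M\<^esub>"
    using rmod_iso_add[OF assms(1), of "\<zero>\<^bsub>M\<^esub>" "\<zero>\<^bsub>M\<^esub>"] by simp
  then show ?thesis
    using rmod_iso_closed[OF assms(1) M.M.zero_closed] by simp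
qed

lemma rmod_iso_sym:
  assumes iso: "rmod_iso R M N h" and M: "right_module R M"
  shows "rmod_iso R N M (inv_into (carrier M) h)"
proof -
  interpret M: right_module R M by fact
  note bij = rmod_iso_bij[OF iso]
  let ?g = "inv_into (carrier M) h"
  have gc: "?g x \<in> carrier M" and hg: "h (?g x) = x" if "x \<in> carrier N" for x
    using that bij by (auto simp: bij_betw_def f_inv_into_f inv_into_into)
  have gh: "?g (h x) = x" if "x \<in> carrier M" for x
    using that bij by (auto simp: bij_betw_def)
  show ?thesis
    unfolding rmod_iso_def
  proof (intro conjI ballI)
    show "bij_betw ?g (carrier N) (carrier M)" using bij by (rule bij_betw_inv_into)
  next
    fix x y assume "x \<in> carrier N" "y \<in> carrier N"
    then show "?g (x \<oplus>\<^bsub>N\<^esub> y) = ?g x \<oplus>\<^bsub>M\<^esub> ?g y"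
      using rmod_iso_add[OF iso, of "?g x" "?g y"] gc hg gh[of "?g x \<oplus>\<^bsub>M\<^esub> ?g y"] by auto
  next
    fix x a assume "x \<in> carrier N" "a \<in> carrier R"
    then show "?g (x \<lhd>\<^bsub>N\<^esub> a) = ?g x \<lhd>\<^bsub>M\<^esub> a"
      using rmod_iso_act[OF iso, of "?g x" a] gc hg gh[of "?g x \<lhd>\<^bsub>M\<^esub> a"] M.ract_closed by auto
  qed
qed

lemma rmod_iso_comp:
  assumes 1: "rmod_iso R M N h" and 2: "rmod_iso R N L g"
  shows "rmod_iso R M L (g \<circ> h)"
  unfolding rmod_iso_def
  using bij_betw_trans[OF rmod_iso_bij[OF 1] rmod_iso_bij[OF 2]]
    rmod_iso_add[OF 1] rmod_iso_act[OF 1] rmod_iso_add[OF 2] rmod_iso_act[OF 2] rmod_iso_closed[OF 1]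
  by simp

text \<open>Each axiom is checked after applying the injective \<open>h\<close>. As \<open>M\<close>
  is not yet known to be a group, additivity of \<open>h\<close> does not yield preservation of
  zero, hence the separate assumption.\<close>

lemma right_module_transport:
  assumes N: "right_module R N" and iso: "rmod_iso R M N h"
    and zero: "\<zero>\<^bsub>M\<^esub> \<in> carrier M" "h \<zero>\<^bsub>M\<^esub> = \<zero>\<^bsub>N\<^esub>"
    and add: "\<And>x y. x \<in> carrier M \<Longrightarrow> y \<in> carrier M \<Longrightarrow> x \<oplus>\<^bsub>M\<^esub> y \<in> carrier M"
    and act: "\<And>x a. x \<in> carrier M \<Longrightarrow> a \<in> carrier R \<Longrightarrow> x \<lhd>\<^bsub>M\<^esub> a \<in> carrier M"
  shows "right_module R M"
proof -
  interpret N: right_module R N by fact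
  note [simp] = zero add act rmod_iso_add[OF iso] rmod_iso_act[OF iso] rmod_iso_closed[OF iso]
  have eqI: "x = y" if "x \<in> carrier M" "y \<in> carrier M" "h x = h y" for x y
    using that rmod_iso_inj[OF iso] by blast
  show ?thesis
  proof (intro right_module.intro right_module_axioms.intro abelian_groupI)
    show "ring R" by (rule N.R.ring_axioms)
    fix x assume x: "x \<in> carrier M"
    then have "\<ominus>\<^bsub>N\<^esub> h x \<in> h ` carrier M" using rmod_iso_bij[OF iso] by (simp add: bij_betw_def)
    then obtain y where "y \<in> carrier M" "h y = \<ominus>\<^bsub>N\<^esub> h x" by auto
    with x show "\<exists>y\<in>carrier M. y \<oplus>\<^bsub>M\<^esub> x = \<zero>\<^bsub>M\<^esub>"
      by (intro bexI[of _ y] eqI) (simp_all add: N.M.l_neg)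
  qed (auto intro!: eqI simp: N.ract_add_left N.ract_add_right N.ract_assoc N.ract_one
        N.M.a_ac)
qed

text \<open>Closure under negation follows from stability under the ring, as -x is x acted on by
  -1.\<close>

lemma rsubmodule_iff:
  assumes "right_module R M"
  shows "rsubmodule H R M \<longleftrightarrow> H \<subseteq> carrier M \<and> \<zero>\<^bsub>M\<^esub> \<in> H \<and> (\<forall>x\<in>H. \<forall>y\<in>H. x \<oplus>\<^bsub>M\<^esub> y \<in> H) \<and>
    (\<forall>x\<in>H. \<forall>a\<in>carrier R. x \<lhd>\<^bsub>M\<^esub> a \<in> H)" (is "_ \<longleftrightarrow> ?rhs")
proof
  assume "rsubmodule H R M"
  then show ?rhs
    by (auto simp: rsubmodule_def additive_subgroup.a_subset additive_subgroup.zero_closed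
        additive_subgroup.a_closed dest: additive_subgroup.a_Hcarr)
next
  interpret right_module R M by fact
  assume rhs: ?rhs
  have neg: "\<ominus>\<^bsub>M\<^esub> x \<in> H" if "x \<in> H" for x
  proof -
    have x: "x \<in> carrier M" using that rhs by blast
    have z: "x \<lhd>\<^bsub>M\<^esub> \<zero>\<^bsub>R\<^esub> = \<zero>\<^bsub>M\<^esub>"
      using ract_add_right[OF x, of "\<zero>\<^bsub>R\<^esub>" "\<zero>\<^bsub>R\<^esub>"] ract_closed[OF x, of "\<zero>\<^bsub>R\<^esub>"] by simp
    have "x \<oplus>\<^bsub>M\<^esub> x \<lhd>\<^bsub>M\<^esub> (\<ominus>\<^bsub>R\<^esub> \<one>\<^bsub>R\<^esub>) = x \<lhd>\<^bsub>M\<^esub> (\<one>\<^bsub>R\<^esub> \<oplus>\<^bsub>R\<^esub> \<ominus>\<^bsub>R\<^esub> \<one>\<^bsub>R\<^esub>)"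
      by (simp only: ract_add_right[OF x] ract_one[OF x] R.one_closed R.a_inv_closed)
    also have "\<dots> = \<zero>\<^bsub>M\<^esub>" by (simp add: R.r_neg z)
    finally have "\<ominus>\<^bsub>M\<^esub> x = x \<lhd>\<^bsub>M\<^esub> (\<ominus>\<^bsub>R\<^esub> \<one>\<^bsub>R\<^esub>)"
      using x ract_closed by (metis M.minus_equality M.a_comm R.a_inv_closed R.one_closed)
    then show ?thesis using rhs that by simp
  qed
  have "subgroup H (add_monoid M)"
    using rhs neg by (intro M.add.subgroupI) auto
  then show "rsubmodule H R M"
    using rhs by (simp add: rsubmodule_def additive_subgroup_def)
qed

lemma rsubmodule_image:
  assumes iso: "rmod_iso R M N h" and M: "right_module R M" and N: "right_module R N"
    and H: "rsubmodule H R M"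
  shows "rsubmodule (h ` H) R N"
proof -
  note H' = H[unfolded rsubmodule_iff[OF M]]
  have c: "x \<in> carrier M" if "x \<in> H" for x using that H' by blast
  have "\<zero>\<^bsub>N\<^esub> \<in> h ` H" using rmod_iso_zero[OF iso M N] H' by (metis imageI)
  moreover have "h x \<oplus>\<^bsub>N\<^esub> h y \<in> h ` H" if "x \<in> H" "y \<in> H" for x y
    using that c H' rmod_iso_add[OF iso] by (metis imageI)
  moreover have "h x \<lhd>\<^bsub>N\<^esub> a \<in> h ` H" if "x \<in> H" "a \<in> carrier R" for x a
    using that c H' rmod_iso_act[OF iso] by (metis imageI)
  ultimately show ?thesis
    using c rmod_iso_closed[OF iso] unfolding rsubmodule_iff[OF N] by auto
qed

lemma rmod_iso_image_trivial:
  assumes iso: "rmod_iso R M N h" and M: "right_module R M" and N: "right_module R N"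
    and H: "H \<subseteq> carrier M"
  shows "h ` H = {\<zero>\<^bsub>N\<^esub>} \<longleftrightarrow> H = {\<zero>\<^bsub>M\<^esub>}"
    and "h ` H = carrier N \<longleftrightarrow> H = carrier M"
proof -
  interpret M: right_module R M by fact
  have inj: "inj_on h (carrier M)" and surj: "h ` carrier M = carrier N"
    using rmod_iso_bij[OF iso] by (auto simp: bij_betw_def)
  have "h ` H = h ` {\<zero>\<^bsub>M\<^esub>} \<longleftrightarrow> H = {\<zero>\<^bsub>M\<^esub>}"
    by (rule inj_on_image_eq_iff[OF inj H]) simp
  then show "h ` H = {\<zero>\<^bsub>N\<^esub>} \<longleftrightarrow> H = {\<zero>\<^bsub>M\<^esub>}"
    by (simp add: rmod_iso_zero[OF iso M N])
  show "h ` H = carrier N \<longleftrightarrow> H = carrier M"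
    using inj_on_image_eq_iff[OF inj H order_refl] surj by simp
qed

lemma simple_rmod_iso:
  assumes iso: "rmod_iso R M N h" and M: "right_module R M" and N: "simple_rmod R N"
  shows "simple_rmod R M"
proof -
  have N': "right_module R N" using N by (simp add: simple_rmod_def)
  interpret M: right_module R M by fact
  note triv = rmod_iso_image_trivial[OF iso M N']
  have surj: "h ` carrier M = carrier N"
    using rmod_iso_bij[OF iso] by (auto simp: bij_betw_def)
  show ?thesis
    unfolding simple_rmod_def
  proof (intro conjI allI impI)
    show "carrier M \<noteq> {\<zero>\<^bsub>M\<^esub>}"
      using triv(1)[of "carrier M"] surj N by (auto simp: simple_rmod_def)
    fix H assume H: "rsubmodule H R M"
    then have "H \<subseteq> carrier M" by (simp add: rsubmodule_iff[OF M])
    then show "H = {\<zero>\<^bsub>M\<^esub>} \<or> H = carrier M"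
      using triv N rsubmodule_image[OF iso M N' H] by (metis simple_rmod_def)
  qed (rule M)
qed

lemma indecomposable_rmod_iso:
  assumes iso: "rmod_iso R M N h" and M: "right_module R M" and N: "indecomposable_rmod R N"
  shows "indecomposable_rmod R M"
proof -
  have N': "right_module R N" using N by (simp add: indecomposable_rmod_def)
  interpret M: right_module R M by fact
  note triv = rmod_iso_image_trivial[OF iso M N']
  have inj: "inj_on h (carrier M)" and surj: "h ` carrier M = carrier N"
    using rmod_iso_bij[OF iso] by (auto simp: bij_betw_def)
  show ?thesis
    unfolding indecomposable_rmod_def
  proof (intro conjI notI)
    show False if "carrier M = {\<zero>\<^bsub>M\<^esub>}"
      using triv(1)[of "carrier M"] surj N that by (auto simp: indecomposable_rmod_def)
    assume "\<exists>H K. rsubmodule H R M \<and> rsubmodule K R M \<and> H \<noteq> {\<zero>\<^bsub>M\<^esub>} \<and> K \<noteq> {\<zero>\<^bsub>M\<^esub>} \<and>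
           H \<inter> K = {\<zero>\<^bsub>M\<^esub>} \<and> H <+>\<^bsub>M\<^esub> K = carrier M"
    then obtain H K where HK: "rsubmodule H R M" "rsubmodule K R M" "H \<noteq> {\<zero>\<^bsub>M\<^esub>}" "K \<noteq> {\<zero>\<^bsub>M\<^esub>}"
      "H \<inter> K = {\<zero>\<^bsub>M\<^esub>}" "H <+>\<^bsub>M\<^esub> K = carrier M" by blast
    have sub: "H \<subseteq> carrier M" "K \<subseteq> carrier M" using HK by (simp_all add: rsubmodule_iff[OF M])
    have "h ` H \<inter> h ` K = {\<zero>\<^bsub>N\<^esub>}"
      using inj_on_image_Int[OF inj sub] HK(5) rmod_iso_zero[OF iso M N'] by simp
    moreover have "h ` H <+>\<^bsub>N\<^esub> h ` K = h ` (H <+>\<^bsub>M\<^esub> K)"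
      using sub by (auto simp: set_add_def' image_UN subset_iff rmod_iso_add[OF iso])
    ultimately show False
      using N HK sub triv(1) rsubmodule_image[OF iso M N'] surj
      unfolding indecomposable_rmod_def by metis
  qed (rule M)
qed

text \<open>The operation \<open>\<lhd>\<close> on \<open>M\<close> need not be additive in its second argument, so that the lemma
  applies to the free abelian group in the construction of the tensor product.\<close>

lemma quot_rmod_iso:
  assumes M: "abelian_group M"
    and act: "\<And>x a. x \<in> carrier M \<Longrightarrow> a \<in> carrier R \<Longrightarrow> x \<lhd>\<^bsub>M\<^esub> a \<in> carrier M"
    and N: "right_module R N"
    and h_add: "\<And>x y. x \<in> carrier M \<Longrightarrow> y \<in> carrier M \<Longrightarrow> h (x \<oplus>\<^bsub>M\<^esub> y) = h x \<oplus>\<^bsub>N\<^esub> h y"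
    and h_act: "\<And>x a. x \<in> carrier M \<Longrightarrow> a \<in> carrier R \<Longrightarrow> h (x \<lhd>\<^bsub>M\<^esub> a) = h x \<lhd>\<^bsub>N\<^esub> a"
    and surj: "h ` carrier M = carrier N"
    and H: "H = {x \<in> carrier M. h x = \<zero>\<^bsub>N\<^esub>}"
  shows "rmod_iso R (quot_rmod M H) N (\<lambda>X. the_elem (h ` X))"
    and "right_module R (quot_rmod M H)"
    and "\<And>x. x \<in> carrier M \<Longrightarrow> the_elem (h ` (H +>\<^bsub>M\<^esub> x)) = h x"
proof -
  interpret M: abelian_group M by fact
  interpret N: right_module R N by fact
  \<comment> \<open>Cosets of the kernel are the fibres of \<open>h\<close>, so operations on cosets
    can be read off from values of \<open>h\<close>.\<close>
  define fib where "fib x = {y \<in> carrier M. h y = h x}" for x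
  have hc: "h x \<in> carrier N" if "x \<in> carrier M" for x using that surj by blast
  have h0: "h \<zero>\<^bsub>M\<^esub> = \<zero>\<^bsub>N\<^esub>"
    using h_add[of "\<zero>\<^bsub>M\<^esub>" "\<zero>\<^bsub>M\<^esub>"] hc[of "\<zero>\<^bsub>M\<^esub>"] by simp
  have diff: "\<exists>z\<in>carrier M. y = z \<oplus>\<^bsub>M\<^esub> x \<and> h y = h z \<oplus>\<^bsub>N\<^esub> h x"
    if "x \<in> carrier M" "y \<in> carrier M" for x y
  proof -
    have "y = (y \<oplus>\<^bsub>M\<^esub> \<ominus>\<^bsub>M\<^esub> x) \<oplus>\<^bsub>M\<^esub> x" using that by (simp add: M.a_assoc M.l_neg)
    then show ?thesis using that h_add by (metis M.a_closed M.a_inv_closed)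
  qed
  have coset: "H +>\<^bsub>M\<^esub> x = fib x" if x: "x \<in> carrier M" for x
  proof (intro equalityI subsetI)
    fix y assume "y \<in> H +>\<^bsub>M\<^esub> x"
    then show "y \<in> fib x" using x hc by (auto simp: a_r_coset_def' H fib_def h_add)
  next
    fix y assume y: "y \<in> fib x"
    then obtain z where z: "z \<in> carrier M" "y = z \<oplus>\<^bsub>M\<^esub> x" "h y = h z \<oplus>\<^bsub>N\<^esub> h x"
      using diff[of x y] x by (auto simp: fib_def)
    then have "h z \<oplus>\<^bsub>N\<^esub> h x = h x" using y by (simp add: fib_def)
    then have "h z = \<zero>\<^bsub>N\<^esub>" using hc x z by simp
    then show "y \<in> H +>\<^bsub>M\<^esub> x" using z by (auto simp: a_r_coset_def' H)
  qed
  have self: "x \<in> fib x" if "x \<in> carrier M" for x using that by (simp add: fib_def)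
  have elem: "the_elem (h ` fib x) = h x" if "x \<in> carrier M" for x
  proof -
    have "h ` fib x = {h x}" using self[OF that] by (auto simp: fib_def)
    then show ?thesis by simp
  qed
  have car: "carrier (quot_rmod M H) = fib ` carrier M"
    by (auto simp: quot_rmod_def A_RCOSETS_def' coset)
  have fib_eq: "fib x = fib y \<longleftrightarrow> h x = h y" if "x \<in> carrier M" "y \<in> carrier M" for x y
    using self that by (auto simp: fib_def)
  have add: "fib x \<oplus>\<^bsub>quot_rmod M H\<^esub> fib y = fib (x \<oplus>\<^bsub>M\<^esub> y)"
    if x: "x \<in> carrier M" and y: "y \<in> carrier M" for x y
  proof -
    have "z \<in> set_add M (fib x) (fib y)" if z: "z \<in> fib (x \<oplus>\<^bsub>M\<^esub> y)" for z
    proof -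
      obtain w where w: "w \<in> carrier M" "z = w \<oplus>\<^bsub>M\<^esub> y" "h z = h w \<oplus>\<^bsub>N\<^esub> h y"
        using diff[of y z] z y by (auto simp: fib_def)
      then have "h w \<oplus>\<^bsub>N\<^esub> h y = h x \<oplus>\<^bsub>N\<^esub> h y" using z x y by (simp add: fib_def h_add)
      then have "h w = h x" using hc x y w by simp
      then have "w \<in> fib x" using w by (simp add: fib_def)
      then show ?thesis using w self[OF y] by (auto simp: set_add_def')
    qed
    moreover have "z \<in> fib (x \<oplus>\<^bsub>M\<^esub> y)" if "z \<in> set_add M (fib x) (fib y)" for z
      using that x y by (auto simp: set_add_def' fib_def h_add)
    ultimately show ?thesis by (auto simp: quot_rmod_def)
  qed
  have fact: "fib x \<lhd>\<^bsub>quot_rmod M H\<^esub> a = fib (x \<lhd>\<^bsub>M\<^esub> a)"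
    if x: "x \<in> carrier M" and a: "a \<in> carrier R" for x a
  proof -
    have "H +>\<^bsub>M\<^esub> (y \<lhd>\<^bsub>M\<^esub> a) = fib (x \<lhd>\<^bsub>M\<^esub> a)" if "y \<in> fib x" for y
      using that x a act coset fib_eq h_act by (simp add: fib_def)
    then show ?thesis using self[OF x] by (auto simp: quot_rmod_def)
  qed
  have zero: "\<zero>\<^bsub>quot_rmod M H\<^esub> = fib \<zero>\<^bsub>M\<^esub>"
    by (simp add: quot_rmod_def H fib_def h0)
  show iso: "rmod_iso R (quot_rmod M H) N (\<lambda>X. the_elem (h ` X))"
    unfolding rmod_iso_def
  proof (intro conjI)
    show "bij_betw (\<lambda>X. the_elem (h ` X)) (carrier (quot_rmod M H)) (carrier N)"
      unfolding bij_betw_def car surj[symmetric] image_image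
      by (auto simp: inj_on_def elem fib_eq)
  qed (auto simp: car add fact elem h_add h_act act)
  show "right_module R (quot_rmod M H)"
    by (rule right_module_transport[OF N iso])
       (auto simp: zero elem h0, auto simp: car add fact act)
  show "the_elem (h ` (H +>\<^bsub>M\<^esub> x)) = h x" if "x \<in> carrier M" for x
    using that by (simp add: coset elem)
qed

section \<open>The algebra as a sum of the subspaces $B X_4^j$\<close>

abbreviation lookup where "lookup \<equiv> Poly_Mapping.lookup"
abbreviation single where "single \<equiv> Poly_Mapping.single"

text \<open>Zero needs no case of its own, being a monomial with coefficient 0.\<close>

lemma poly_mapping_single_induct [case_names single add]:
  assumes single: "\<And>k c. P (single k c)" and add: "\<And>p q. P p \<Longrightarrow> P q \<Longrightarrow> P (p + q)"
  shows "P p"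
proof (induction p rule: update_induct)
  case const
  show ?case using single[of undefined 0] by simp
next
  case (update f a b)
  have "Poly_Mapping.update a b f = f + single a b"
    using update(1) by (intro poly_mapping_eqI)
      (auto simp: lookup_update lookup_add lookup_single when_def in_keys_iff)
  then show ?case using add[OF update(3) single] by simp
qed

lemma fscalar_commute: "p * fscalar c = fscalar c * p"
proof (induction p rule: poly_mapping_single_induct)
  case (single k c)
  then show ?case by (simp add: fscalar_def mult_single mult.commute)
qed (simp add: distrib_left distrib_right)

lemma fscalar_mult: "fscalar a * fscalar b = fscalar (a * b)"
  by (simp add: fscalar_def mult_single)

lemma fscalar_1: "fscalar 1 = 1"
  by (simp add: fscalar_def)

lemma fscalar_uminus: "- p = fscalar (- 1) * p"
  by (simp add: fscalar_def single_uminus)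

lemma fscalar_left: "fscalar c * (fscalar d * p) = fscalar (c * d) * p"
  by (simp add: fscalar_mult mult.assoc[symmetric])

text \<open>The first defining relation is X1 X2 = s^2 X2 X1 with \<open>X2\<close> expanded. In
  this form it compares two products of weighted shifts in the model.\<close>

lemma FX1_FX2_relation:
  "FX1 * FX2 r - fscalar (s^2) * FX2 r * FX1 =
    fgen E1 ^ 2 * fgen E2 - fscalar (r^2 + s^2) * fgen E1 * fgen E2 * fgen E1
      + fscalar (r^2 * s^2) * fgen E2 * fgen E1 ^ 2"
  by (rule poly_mapping_eqI)
    (auto simp: FX1_def FX2_def fscalar_def fgen_def mult_single power2_eq_square zero_word_def
      right_diff_distrib left_diff_distrib lookup_add lookup_minus lookup_single when_def algebra_simps)

text \<open>The second defining relation is X3 X4 = r s X4 X3 up to a scalar: -1/s^2 is the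
  coefficient of e1 e2^3 on the left, coming from the term X2 e2 of \<open>X3\<close>.\<close>

lemma FX3_FX4_relation:
  assumes "s \<noteq> 0"
  shows "FX3 r s * FX4 - fscalar (r * s) * FX4 * FX3 r s =
    fscalar (- 1 / s^2) * (fgen E1 * fgen E2 ^ 3 - fscalar (r^2 + r*s + s^2) * fgen E2 * fgen E1 * fgen E2 ^ 2
        + fscalar (r * s * (r^2 + r*s + s^2)) * fgen E2 ^ 2 * fgen E1 * fgen E2
        - fscalar (r^3 * s^3) * fgen E2 ^ 3 * fgen E1)"
  using assms
  by (intro poly_mapping_eqI)
    (auto simp: FX4_def FX2_def FX3_def fscalar_def fgen_def mult_single power2_eq_square power3_eq_cube
      zero_word_def right_diff_distrib left_diff_distrib distrib_left distrib_right
      lookup_add lookup_minus lookup_single when_def field_simps)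

section \<open>The algebra \<open>U\<close> as a quotient of the free algebra\<close>

lemma ring_free_ring: "ring free_ring"
proof (intro ringI abelian_groupI monoidI)
  fix x :: free_alg
  show "\<exists>y\<in>carrier free_ring. y \<oplus>\<^bsub>free_ring\<^esub> x = \<zero>\<^bsub>free_ring\<^esub>"
    by (rule bexI[of _ "- x"]) (simp_all add: free_ring_def)
qed (simp_all add: free_ring_def algebra_simps)

lemma ideal_U_ideal: "ideal (U_ideal r s) free_ring"
  unfolding U_ideal_def
  by (rule ring.genideal_ideal[OF ring_free_ring]) (simp add: free_ring_def)

lemma U_relations_subset: "U_relations r s \<subseteq> U_ideal r s"
  unfolding U_ideal_def
  by (rule ring.genideal_self[OF ring_free_ring]) (simp add: free_ring_def)

lemma ring_U: "ring (U r s)"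
  unfolding U_def by (rule ideal.quotient_is_ring[OF ideal_U_ideal])

lemma U_class_hom: "U_class r s \<in> ring_hom free_ring (U r s)"
  unfolding U_def U_class_def[abs_def] using ideal.rcos_ring_hom[OF ideal_U_ideal] by simp

lemma U_class_add: "U_class r s (p + q) = U_class r s p \<oplus>\<^bsub>U r s\<^esub> U_class r s q"
  using ring_hom_add[OF U_class_hom, of p q] by (simp add: free_ring_def)

lemma U_class_mult: "U_class r s (p * q) = U_class r s p \<otimes>\<^bsub>U r s\<^esub> U_class r s q"
  using ring_hom_mult[OF U_class_hom, of p q] by (simp add: free_ring_def)

lemma U_class_one: "U_class r s 1 = \<one>\<^bsub>U r s\<^esub>"
  using ring_hom_one[OF U_class_hom] by (simp add: free_ring_def)

lemma carrier_U: "carrier (U r s) = range (U_class r s)"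
  by (auto simp: U_def FactRing_def A_RCOSETS_def' U_class_def free_ring_def)

lemma U_class_in [simp]: "U_class r s p \<in> carrier (U r s)"
  by (simp add: carrier_U)

lemma U_class_uminus: "U_class r s (- p) = \<ominus>\<^bsub>U r s\<^esub> U_class r s p"
proof -
  interpret ring "U r s" by (rule ring_U)
  have "U_class r s 0 = \<zero>\<^bsub>U r s\<^esub>"
    using U_class_add[of r s 0 0] by simp
  then show ?thesis
    using U_class_add[of r s "- p" p] by (simp add: minus_equality)
qed

lemma U_class_power: "U_class r s (p ^ n) = U_class r s p [^]\<^bsub>U r s\<^esub> n"
proof -
  interpret ring "U r s" by (rule ring_U)
  show ?thesis by (induction n) (simp_all add: U_class_one U_class_mult power_Suc2 del: power_Suc)
qed

lemma U_class_eq_iff: "U_class r s p = U_class r s q \<longleftrightarrow> p - q \<in> U_ideal r s"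
proof -
  interpret ideal "U_ideal r s" free_ring by (rule ideal_U_ideal)
  have neg: "\<ominus>\<^bsub>free_ring\<^esub> x = - x" for x
    by (rule minus_equality) (simp_all add: free_ring_def)
  have "U_class r s p = U_class r s q \<longleftrightarrow> p \<ominus>\<^bsub>free_ring\<^esub> q \<in> U_ideal r s"
    unfolding U_class_def
    using ring.quotient_eq_iff_same_a_r_cos[OF ring_free_ring ideal_U_ideal, of p q]
    by (auto simp: free_ring_def)
  then show ?thesis by (simp add: a_minus_def neg) (simp add: free_ring_def)
qed

lemma U_ideal_scalar: "p \<in> U_ideal r s \<Longrightarrow> fscalar c * p \<in> U_ideal r s"
  using ideal.I_l_closed[OF ideal_U_ideal, of p r s "fscalar c"] by (simp add: free_ring_def)

text \<open>The rules moving \<open>X4\<close> right past \<open>X1\<close> and \<open>X2\<close>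
  are the definitions of \<open>X2\<close> and \<open>X3\<close>, solved for the left side, and hold
  in the free algebra. The rule for \<open>X3\<close> is the second relation and holds in the
  quotient.\<close>

lemma FX4_FX1: "r \<noteq> 0 \<Longrightarrow> FX4 * FX1 = fscalar (- 1 / r^2) * FX2 r + fscalar (1 / r^2) * FX1 * FX4"
  by (rule poly_mapping_eqI)
    (auto simp: FX1_def FX4_def FX2_def fscalar_def fgen_def mult_single power2_eq_square zero_word_def
      right_diff_distrib left_diff_distrib lookup_add lookup_minus lookup_single when_def field_simps)

lemma FX4_FX2: "FX4 * FX2 r = FX3 r s + fscalar (1 / s^2) * FX2 r * FX4"
  by (simp add: FX3_def FX4_def)

lemma U_class_FX4_FX3:
  assumes "r \<noteq> 0" "s \<noteq> 0"
  shows "U_class r s (FX4 * FX3 r s) = U_class r s (fscalar (1 / (r * s)) * FX3 r s * FX4)"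
proof -
  have "FX3 r s * FX4 - fscalar (r * s) * FX4 * FX3 r s \<in> U_ideal r s"
    unfolding FX3_FX4_relation[OF assms(2)]
    by (intro U_ideal_scalar subsetD[OF U_relations_subset]) (simp add: U_relations_def Let_def)
  then have "fscalar (- 1 / (r * s)) * (FX3 r s * FX4 - fscalar (r * s) * FX4 * FX3 r s) \<in> U_ideal r s"
    by (rule U_ideal_scalar)
  moreover have "fscalar (- 1 / (r * s)) * (FX3 r s * FX4 - fscalar (r * s) * FX4 * FX3 r s)
      = FX4 * FX3 r s - fscalar (1 / (r * s)) * FX3 r s * FX4"
    using assms by (simp add: right_diff_distrib mult.assoc fscalar_left)
      (simp add: fscalar_def single_uminus)
  ultimately show ?thesis by (simp add: U_class_eq_iff)
qed

text \<open>Representatives in the free algebra for the elements of \<open>B\<close>, so that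
  inductions over \<open>B\<close> compute with polynomials instead of cosets. One and negatives
  come from the scalars.\<close>

inductive_set B_free :: "complex \<Rightarrow> complex \<Rightarrow> free_alg set" for r s where
  scalar: "fscalar c \<in> B_free r s"
| X1: "FX1 \<in> B_free r s"
| X2: "FX2 r \<in> B_free r s"
| X3: "FX3 r s \<in> B_free r s"
| add: "p \<in> B_free r s \<Longrightarrow> q \<in> B_free r s \<Longrightarrow> p + q \<in> B_free r s"
| mult: "p \<in> B_free r s \<Longrightarrow> q \<in> B_free r s \<Longrightarrow> p * q \<in> B_free r s"

lemma carrier_U_B: "carrier (U_B r s) = U_class r s ` B_free r s"
proof (intro equalityI subsetI)
  fix u assume "u \<in> carrier (U_B r s)"
  then have "u \<in> generate_ring (U r s) (range (U_scalar r s) \<union> {X1 r s, X2 r s, X3 r s})"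
    by (simp add: U_B_def)
  then show "u \<in> U_class r s ` B_free r s"
  proof induction
    case one
    show ?case using B_free.scalar[of 1 r s] by (metis U_class_one fscalar_1 imageI)
  next
    case (incl h)
    then show ?case by (auto simp: U_scalar_def X1_def X2_def X3_def intro: B_free.intros)
  next
    case (a_inv h)
    then show ?case
      by (auto simp flip: U_class_uminus simp: fscalar_uminus intro!: imageI B_free.mult B_free.scalar)
  next
    case (eng_add h1 h2)
    then show ?case by (auto simp flip: U_class_add intro: B_free.add)
  next
    case (eng_mult h1 h2)
    then show ?case by (auto simp flip: U_class_mult intro: B_free.mult)
  qed
next
  fix u assume "u \<in> U_class r s ` B_free r s"
  then obtain p where p: "p \<in> B_free r s" "u = U_class r s p" by auto
  from p(1) have "U_class r s p \<in> generate_ring (U r s) (range (U_scalar r s) \<union> {X1 r s, X2 r s, X3 r s})"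
    by induction (auto simp: U_scalar_def X1_def X2_def X3_def U_class_add U_class_mult
        intro: generate_ring.intros)
  then show "u \<in> carrier (U_B r s)" by (simp add: p U_B_def)
qed

lemma ring_U_B: "ring (U_B r s)"
  unfolding U_B_def
  by (rule ring.generate_ring_is_ring[OF ring_U]) (auto simp: U_scalar_def X1_def X2_def X3_def)

text \<open>The commutation pattern of an Ore extension, X4 B inside B + B X4. It passes to products
  since X4 p q = (a + b X4) q, where \<open>X4\<close> moves past \<open>q\<close> once
  more.\<close>

lemma FX4_B_free:
  assumes rs: "r \<noteq> 0" "s \<noteq> 0" and "b \<in> B_free r s"
  shows "\<exists>b0\<in>B_free r s. \<exists>b1\<in>B_free r s. U_class r s (FX4 * b) = U_class r s (b0 + b1 * FX4)"
  using assms(3)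
proof induction
  case (scalar c)
  have "FX4 * fscalar c = fscalar 0 + fscalar c * FX4"
    by (simp add: fscalar_commute) (simp add: fscalar_def)
  then show ?case using B_free.scalar by (metis (no_types))
next
  case X1
  show ?case using FX4_FX1[OF rs(1)] B_free.intros by (metis (no_types))
next
  case X2
  show ?case using FX4_FX2[of r s] B_free.intros by (metis (no_types))
next
  case X3
  have "U_class r s (FX4 * FX3 r s) = U_class r s (fscalar 0 + fscalar (1 / (r * s)) * FX3 r s * FX4)"
    by (simp add: U_class_FX4_FX3[OF rs]) (simp add: fscalar_def)
  then show ?case using B_free.intros by (metis (no_types))
next
  case (add p q)
  then obtain a b c d where *: "a \<in> B_free r s" "b \<in> B_free r s" "c \<in> B_free r s" "d \<in> B_free r s"
    "U_class r s (FX4 * p) = U_class r s (a + b * FX4)"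
    "U_class r s (FX4 * q) = U_class r s (c + d * FX4)" by blast
  have "U_class r s (FX4 * (p + q)) = U_class r s ((a + b * FX4) + (c + d * FX4))"
    unfolding distrib_left U_class_add *(5,6) ..
  also have "(a + b * FX4) + (c + d * FX4) = (a + c) + (b + d) * FX4"
    by (simp add: distrib_right add_ac)
  finally show ?case using * B_free.add by (metis (no_types))
next
  case (mult p q)
  then obtain a b c d where *: "a \<in> B_free r s" "b \<in> B_free r s" "c \<in> B_free r s" "d \<in> B_free r s"
    "U_class r s (FX4 * p) = U_class r s (a + b * FX4)"
    "U_class r s (FX4 * q) = U_class r s (c + d * FX4)" by blast
  have "U_class r s (FX4 * (p * q)) = U_class r s (a * q + b * (FX4 * q))"
    using *(5) by (metis U_class_mult mult.assoc distrib_right)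
  also have "\<dots> = U_class r s ((a * q + b * c) + b * d * FX4)"
    using *(6) by (metis U_class_mult U_class_add mult.assoc distrib_left add.assoc)
  finally show ?case using * mult B_free.intros by (metis (no_types))
qed

inductive_set BX4 :: "complex \<Rightarrow> complex \<Rightarrow> free_alg set" for r s where
  base: "b \<in> B_free r s \<Longrightarrow> b * FX4 ^ j \<in> BX4 r s"
| add: "p \<in> BX4 r s \<Longrightarrow> q \<in> BX4 r s \<Longrightarrow> p + q \<in> BX4 r s"

lemma BX4_left_B:
  assumes "b \<in> B_free r s" "p \<in> BX4 r s"
  shows "b * p \<in> BX4 r s"
  using assms(2) by induction
    (auto simp: distrib_left mult.assoc[symmetric] intro: BX4.intros B_free.mult assms(1))

lemma BX4_left_FX4:
  assumes rs: "r \<noteq> 0" "s \<noteq> 0" and "p \<in> BX4 r s"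
  shows "\<exists>q\<in>BX4 r s. U_class r s (FX4 * p) = U_class r s q"
  using assms(3)
proof induction
  case (base b j)
  obtain b0 b1 where *: "b0 \<in> B_free r s" "b1 \<in> B_free r s"
    "U_class r s (FX4 * b) = U_class r s (b0 + b1 * FX4)"
    using FX4_B_free[OF rs base] by blast
  have "U_class r s (FX4 * (b * FX4 ^ j)) = U_class r s ((b0 + b1 * FX4) * FX4 ^ j)"
    using *(3) by (metis U_class_mult mult.assoc)
  also have "(b0 + b1 * FX4) * FX4 ^ j = b0 * FX4 ^ j + b1 * FX4 ^ Suc j"
    by (simp add: distrib_right mult.assoc)
  finally show ?case using * BX4.intros by (metis (no_types))
next
  case (add p q)
  then show ?case by (metis BX4.add U_class_add distrib_left)
qed

text \<open>The span of the B X4^j absorbs left multiplication by both generators, because e1 lies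
  in \<open>B\<close> and e2 moves past \<open>B\<close>. Words are built from their right end,
  starting with a scalar.\<close>

lemma U_class_BX4:
  assumes rs: "r \<noteq> 0" "s \<noteq> 0"
  shows "\<exists>q\<in>BX4 r s. U_class r s p = U_class r s q"
proof (induction p rule: poly_mapping_single_induct)
  case (single w c)
  obtain gs where w: "w = Word gs" by (cases w)
  show ?case unfolding w
  proof (induction gs)
    case Nil
    have "fscalar c * FX4 ^ 0 \<in> BX4 r s" by (intro BX4.base B_free.scalar)
    then show ?case by (auto simp: fscalar_def zero_word_def)
  next
    case (Cons g gs)
    then obtain q where q: "q \<in> BX4 r s" "U_class r s (single (Word gs) c) = U_class r s q" by auto
    have "single (Word (g # gs)) c = fgen g * single (Word gs) c"
      by (simp add: fgen_def mult_single)
    then have "U_class r s (single (Word (g # gs)) c) = U_class r s (fgen g * q)"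
      using q by (simp add: U_class_mult)
    then show ?case
    proof (cases g)
      case E1
      then show ?thesis using BX4_left_B[OF B_free.X1 q(1)]
        \<open>U_class r s (single (Word (g # gs)) c) = U_class r s (fgen g * q)\<close> by (auto simp: FX1_def)
    next
      case E2
      then show ?thesis using BX4_left_FX4[OF rs q(1)]
        \<open>U_class r s (single (Word (g # gs)) c) = U_class r s (fgen g * q)\<close> by (simp add: FX4_def)
    qed
  qed
next
  case (add p q)
  then show ?case by (metis BX4.add U_class_add)
qed

lemma U_span_induct [consumes 2, case_names base add]:
  assumes rs: "r \<noteq> 0" "s \<noteq> 0"
    and base: "\<And>b j. b \<in> B_free r s \<Longrightarrow> P (U_class r s (b * FX4 ^ j))"
    and add: "\<And>p q. P (U_class r s p) \<Longrightarrow> P (U_class r s q) \<Longrightarrow> P (U_class r s (p + q))"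
  shows "P (U_class r s p)"
proof -
  obtain q where q: "q \<in> BX4 r s" "U_class r s p = U_class r s q"
    using U_class_BX4[OF rs] by blast
  from q(1) have "P (U_class r s q)" by induction (auto intro: base add)
  then show ?thesis by (simp add: q)
qed

section \<open>A concrete model of $M(\lambda)$\<close>

lift_definition smul :: "complex \<Rightarrow> ('a \<Rightarrow>\<^sub>0 complex) \<Rightarrow> ('a \<Rightarrow>\<^sub>0 complex)" is "\<lambda>c v k. c * v k"
  by (rule finite_subset[rotated]) auto

text \<open>Sends f(k + d) to c(k) f(k). Indexing the weight by the target makes f(0), ..., f(d - 1)
  vanish without a case distinction.\<close>

lift_definition lower :: "nat \<Rightarrow> (nat \<Rightarrow> complex) \<Rightarrow> (nat \<Rightarrow>\<^sub>0 complex) \<Rightarrow> (nat \<Rightarrow>\<^sub>0 complex)"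
  is "\<lambda>d c v k. c k * v (k + d)"
proof -
  fix d :: nat and c v :: "nat \<Rightarrow> complex"
  assume "finite {k. v k \<noteq> 0}"
  then have "finite ((\<lambda>k. k + d) -` {k. v k \<noteq> 0})"
    by (rule finite_vimageI) (simp add: inj_on_def)
  then show "finite {k. c k * v (k + d) \<noteq> 0}"
    by (rule finite_subset[rotated]) auto
qed

lift_definition raise :: "(nat \<Rightarrow>\<^sub>0 complex) \<Rightarrow> (nat \<Rightarrow>\<^sub>0 complex)"
  is "\<lambda>v k. case k of 0 \<Rightarrow> 0 | Suc j \<Rightarrow> v j"
proof -
  fix v :: "nat \<Rightarrow> complex"
  assume "finite {k. v k \<noteq> 0}"
  then have "finite (Suc ` {k. v k \<noteq> 0})" by simp
  then show "finite {k. (case k of 0 \<Rightarrow> 0 | Suc j \<Rightarrow> v j) \<noteq> 0}"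
    by (rule finite_subset[rotated]) (auto simp: gr0_conv_Suc split: nat.splits)
qed

lift_definition trunc :: "nat \<Rightarrow> (nat \<Rightarrow>\<^sub>0 complex) \<Rightarrow> (nat \<Rightarrow>\<^sub>0 complex)"
  is "\<lambda>N v k. if k < N then v k else 0"
  by (rule finite_subset[rotated]) auto

lemmas lookup_ops = smul.rep_eq lower.rep_eq raise.rep_eq trunc.rep_eq

lemma smul_simps:
  "smul 1 v = v" "smul 0 v = 0" "smul c 0 = 0" "smul (- 1) v = - v"
  "smul c (v + w) = smul c v + smul c w" "smul (c + d) v = smul c v + smul d v"
  "smul c (smul d v) = smul (c * d) v" "smul c (single k d) = single k (c * d)"
  by (auto intro!: poly_mapping_eqI simp: lookup_ops lookup_add algebra_simps lookup_single when_def)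

lemma trunc_simps:
  "trunc N (v + w) = trunc N v + trunc N w" "trunc N (smul c v) = smul c (trunc N v)" "trunc N 0 = 0"
  "trunc N (trunc N v) = trunc N v" "trunc N (v - w) = trunc N v - trunc N w"
  "trunc N (single k c) = (if k < N then single k c else 0)"
  by (auto intro!: poly_mapping_eqI simp: lookup_ops lookup_add lookup_minus lookup_single when_def)

lemma trunc_eq_self_iff: "trunc N v = v \<longleftrightarrow> Poly_Mapping.keys v \<subseteq> {..<N}"
  by (auto simp: poly_mapping_eq_iff fun_eq_iff lookup_ops in_keys_iff subset_iff)

lemma trunc_eq_0_iff: "trunc N v = 0 \<longleftrightarrow> (\<forall>k<N. lookup v k = 0)"
  by (auto simp: poly_mapping_eq_iff fun_eq_iff lookup_ops)

definition linear_op :: "(('a \<Rightarrow>\<^sub>0 complex) \<Rightarrow> ('b \<Rightarrow>\<^sub>0 complex)) \<Rightarrow> bool" where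
  "linear_op f \<longleftrightarrow> (\<forall>v w. f (v + w) = f v + f w) \<and> (\<forall>c v. f (smul c v) = smul c (f v))"

lemma linear_op_lower: "linear_op (lower d c)"
  by (auto simp: linear_op_def lookup_ops lookup_add algebra_simps intro!: poly_mapping_eqI)

lemma linear_op_raise: "linear_op raise"
  by (auto simp: linear_op_def lookup_ops lookup_add algebra_simps intro!: poly_mapping_eqI split: nat.splits)

lemma lower_single:
  "lower d c (single a z) = (if d \<le> a then single (a - d) (c (a - d) * z) else 0)"
  by (auto intro!: poly_mapping_eqI simp: lookup_ops lookup_single when_def)

lemma raise_single: "raise (single a z) = single (Suc a) z"
  by (rule poly_mapping_eqI) (auto simp: lookup_ops lookup_single when_def split: nat.splits)

lemma trunc_min: "M \<le> N \<Longrightarrow> trunc M (trunc N v) = trunc M v"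
  by (auto intro!: poly_mapping_eqI simp: lookup_ops)

lemma trunc_fixed_less: "trunc N v = v \<Longrightarrow> lookup v j \<noteq> 0 \<Longrightarrow> j < N"
  by (metis trunc.rep_eq)

lemma abelian_group_poly_mapping:
  fixes M :: "('a, 'k \<Rightarrow>\<^sub>0 'b :: ab_group_add, 'n) rmod_scheme"
  assumes "add M = (+)" "zero M = 0" "\<And>x. x \<in> carrier M \<Longrightarrow> - x \<in> carrier M" "0 \<in> carrier M"
    "\<And>x y. x \<in> carrier M \<Longrightarrow> y \<in> carrier M \<Longrightarrow> x + y \<in> carrier M"
  shows "abelian_group M"
proof (rule abelian_groupI)
  fix x assume "x \<in> carrier M"
  then show "\<exists>y\<in>carrier M. y \<oplus>\<^bsub>M\<^esub> x = \<zero>\<^bsub>M\<^esub>"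
    by (intro bexI[of _ "- x"]) (simp_all add: assms)
qed (simp_all add: assms algebra_simps)

lemma vec_rmod_simps:
  "carrier (vec_rmod N act) = {v. Poly_Mapping.keys v \<subseteq> {..<N}}" "zero (vec_rmod N act) = 0"
  "add (vec_rmod N act) = (+)" "ract (vec_rmod N act) = act"
  by (simp_all add: vec_rmod_def)

lemma complex_rmod_simps:
  "carrier (complex_rmod act) = UNIV" "zero (complex_rmod act) = 0" "add (complex_rmod act) = (+)"
  "ract (complex_rmod act) = act"
  by (simp_all add: complex_rmod_def)

lemma U_B_simps: "add (U_B r s) = add (U r s)" "mult (U_B r s) = mult (U r s)" "one (U_B r s) = one (U r s)"
  by (simp_all add: U_B_def)

lemma mult_ord:
  assumes "n > 0" "z ^ n = 1"
  shows "mult_ord z > 0" "z ^ mult_ord z = 1" "\<And>j. 0 < j \<Longrightarrow> j < mult_ord z \<Longrightarrow> z ^ j \<noteq> 1"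
proof -
  have eq: "mult_ord z = (LEAST n. n > 0 \<and> z ^ n = 1)"
    unfolding mult_ord_def using assms by (intro if_P) blast
  show "mult_ord z > 0" "z ^ mult_ord z = 1"
    unfolding eq using LeastI[of "\<lambda>n. n > 0 \<and> z ^ n = 1" n] assms by simp_all
  show "z ^ j \<noteq> 1" if "0 < j" "j < mult_ord z" for j
    using not_less_Least[of j "\<lambda>n. n > 0 \<and> z ^ n = 1"] that unfolding eq by blast
qed

section \<open>The weights of the model and the identities between them\<close>

locale verma =
  fixes r s lam :: complex
  assumes r0: "r \<noteq> 0" and s0: "s \<noteq> 0" and rs2: "r^2 \<noteq> s^2"
begin

definition q :: complex where "q = r * inverse s"

lemma q_neq: "q \<noteq> 0" "q \<noteq> 1" "q^2 \<noteq> 1"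
  using r0 s0 rs2 by (auto simp: q_def field_simps power2_eq_square)

text \<open>The coefficients of the action on \<open>f(k + 2)\<close>, \<open>f(k + 1)\<close> and \<open>f(k)\<close>, respectively; the shift
  of the index avoids truncated subtraction.\<close>

definition coeff1 :: "nat \<Rightarrow> complex" where
  "coeff1 k = - lam / r^(2 * (k + 1)) * ((1 - q^(k + 1)) / (1 - q)) * ((1 - q^(k + 2)) / (1 - q^2))"

definition coeff2 :: "nat \<Rightarrow> complex" where
  "coeff2 k = lam / (r * s)^k * ((1 - q^(k + 1)) / (1 - q))"

definition coeff3 :: "nat \<Rightarrow> complex" where
  "coeff3 k = lam / (r * s)^k"

text \<open>The equation X2 = X1 X4 - r^2 X4 X1, applied to f(k + 1). In a right action X1 X4
  applies \<open>X1\<close> first, so its weight has target k - 1, and for k = 0 this term is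
  absent.\<close>

lemma coeff_X2: "(if k = 0 then 0 else coeff1 (k - 1)) - r^2 * coeff1 k = coeff2 k"
proof (cases k)
  case 0
  have "1 - q \<noteq> 0" "1 - q * q \<noteq> 0" using q_neq by (auto simp: power2_eq_square)
  with 0 r0 show ?thesis by (simp add: coeff1_def coeff2_def power2_eq_square)
next
  case (Suc j)
  have nz: "1 - q \<noteq> 0" "1 - q * q \<noteq> 0" using q_neq by (auto simp: power2_eq_square)
  \<comment> \<open>It follows that r^(2k) = (r s)^k q^k, so that after naming the two powers
    \<open>A\<close> and \<open>B\<close> an identity of rational functions remains.\<close>
  have rs: "r * s * q = r^2" using s0 by (simp add: q_def power2_eq_square)
  have p: "(r * s)^Suc j * q^Suc j = r^(2 * Suc j)"
    by (metis rs power_mult power_mult_distrib)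
  define A where "A = q^Suc j"
  define B where "B = (r * s)^Suc j"
  have nzA: "A \<noteq> 0" "B \<noteq> 0" using q_neq r0 s0 by (auto simp: A_def B_def)
  have pj: "r^(2 * (j + 1)) = B * A" "r^(2 * (Suc j + 1)) = r^2 * (B * A)"
    unfolding A_def B_def p power_add[symmetric] by simp_all
  have qj: "q^(j + 1) = A" "q^(j + 2) = A * q" "q^(Suc j + 1) = A * q" "q^(Suc j + 2) = A * q * q"
    by (simp_all add: A_def)
  have "coeff1 j = - lam / (B * A) * ((1 - A) / (1 - q)) * ((1 - A * q) / (1 - q * q))"
    unfolding coeff1_def pj qj by (simp add: power2_eq_square)
  moreover have "r^2 * coeff1 (Suc j) = - lam / (B * A) * ((1 - A * q) / (1 - q)) * ((1 - A * q * q) / (1 - q * q))"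
    using r0 unfolding coeff1_def pj qj by (simp add: power2_eq_square mult.assoc)
  moreover have "coeff2 (Suc j) = lam / B * ((1 - A * q) / (1 - q))"
    by (simp add: coeff2_def A_def B_def mult_ac)
  moreover have "- lam / (B * A) * ((1 - A) / (1 - q)) * ((1 - A * q) / (1 - q * q)) -
     - lam / (B * A) * ((1 - A * q) / (1 - q)) * ((1 - A * q * q) / (1 - q * q)) =
     lam / B * ((1 - A * q) / (1 - q))"
    using nz nzA by (simp add: divide_simps) (simp add: algebra_simps)
  ultimately show ?thesis using Suc by simp
qed

text \<open>The equation X3 = X4 X2 - s^(-2) X2 X4, applied to f(k). Both products return to f(k),
  so \<open>X3\<close> is diagonal.\<close>

lemma coeff_X3: "coeff2 k - (if k = 0 then 0 else 1 / s^2 * coeff2 (k - 1)) = coeff3 k"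
proof (cases k)
  case 0
  then show ?thesis using q_neq by (simp add: coeff2_def coeff3_def)
next
  case (Suc j)
  have nz: "1 - q \<noteq> 0" using q_neq by auto
  define A where "A = q^Suc j"
  define B where "B = (r * s)^Suc j"
  have nzA: "A \<noteq> 0" "B \<noteq> 0" using q_neq r0 s0 by (auto simp: A_def B_def)
  \<comment> \<open>One factor r s of \<open>B\<close> absorbs q, as q / (r s) = 1 / s^2.\<close>
  have "q / B = 1 / s^2 / (r * s)^j"
    using r0 s0 by (simp add: B_def q_def power2_eq_square field_simps)
  moreover have "1 / s^2 * coeff2 j = lam * (1 / s^2 / (r * s)^j) * ((1 - A) / (1 - q))"
    by (simp add: coeff2_def A_def)
  ultimately have "1 / s^2 * coeff2 j = lam * (q / B) * ((1 - A) / (1 - q))"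
    by simp
  then have "1 / s^2 * coeff2 j = lam * q / B * ((1 - A) / (1 - q))"
    by simp
  moreover have "coeff2 (Suc j) = lam / B * ((1 - A * q) / (1 - q))"
    by (simp add: coeff2_def A_def B_def mult_ac)
  moreover have "coeff3 (Suc j) = lam / B" by (simp add: coeff3_def B_def)
  moreover have "lam / B * ((1 - A * q) / (1 - q)) - lam * q / B * ((1 - A) / (1 - q)) = lam / B"
    using nz nzA by (simp add: divide_simps) (simp add: algebra_simps)
  ultimately show ?thesis using Suc by simp
qed

text \<open>The relation X1 X2 = s^2 X2 X1 on f(k + 3). Both sides carry the factors 1 - q^(k+1), 1
  - q^(k+2), 1 - q^(k+3); only the powers of r and s differ, by s^2.\<close>

lemma coeff_X1_X2: "coeff2 k * coeff1 (k + 1) = s^2 * (coeff1 k * coeff2 (k + 2))"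
  using r0 s0 by (simp add: coeff1_def coeff2_def power2_eq_square mult_ac)

lemma coeff_X3_X4: "coeff3 k = r * s * coeff3 (k + 1)"
  using r0 s0 by (simp add: coeff3_def)

section \<open>The action of the free algebra and of \<open>U\<close> on sequences\<close>

primrec gen_act :: "gen \<Rightarrow> (nat \<Rightarrow>\<^sub>0 complex) \<Rightarrow> (nat \<Rightarrow>\<^sub>0 complex)" where
  "gen_act E1 = lower 2 coeff1"
| "gen_act E2 = raise"

text \<open>\<open>fold\<close> lets the leftmost letter act first, as a right action
  requires.\<close>

primrec word_act :: "word \<Rightarrow> (nat \<Rightarrow>\<^sub>0 complex) \<Rightarrow> (nat \<Rightarrow>\<^sub>0 complex)" where
  "word_act (Word gs) = fold gen_act gs"

lemma word_act_plus: "word_act (u + w) v = word_act w (word_act u v)"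
  by (cases u; cases w) simp

lemma linear_word_act: "linear_op (word_act w)"
proof (cases w)
  case (Word gs)
  have "linear_op (gen_act g)" for g
    by (cases g) (simp_all add: linear_op_lower linear_op_raise)
  then have "linear_op (fold gen_act gs)"
    by (induction gs) (simp_all add: linear_op_def)
  then show ?thesis by (simp add: Word)
qed

definition rep :: "free_alg \<Rightarrow> (nat \<Rightarrow>\<^sub>0 complex) \<Rightarrow> (nat \<Rightarrow>\<^sub>0 complex)" where
  "rep p v = (\<Sum>w\<in>Poly_Mapping.keys p. smul (lookup p w) (word_act w v))"

lemma rep_add: "rep (p + p') v = rep p v + rep p' v"
  unfolding rep_def by (rule setsum_keys_plus_distrib) (simp_all add: smul_simps)

lemma rep_single: "rep (single w c) v = smul c (word_act w v)"
  by (simp add: rep_def smul_simps)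

lemma linear_rep: "linear_op (rep p)"
proof (induction p rule: poly_mapping_single_induct)
  case (single k c)
  then show ?case using linear_word_act[of k]
    by (simp add: linear_op_def rep_single smul_simps mult.commute)
qed (simp add: linear_op_def rep_add smul_simps algebra_simps)

lemma rep_linear:
  "rep p (v + w) = rep p v + rep p w" "rep p (smul c v) = smul c (rep p v)" "rep p 0 = 0"
proof -
  show "rep p (v + w) = rep p v + rep p w" "rep p (smul c v) = smul c (rep p v)" for v w c
    using linear_rep[of p] by (simp_all add: linear_op_def)
  from this(2)[of 0 0] show "rep p 0 = 0" by (simp add: smul_simps)
qed

lemma rep_mult: "rep (p * p') v = rep p' (rep p v)"
proof (induction p arbitrary: v rule: poly_mapping_single_induct)
  case (single k c)
  show ?case
  proof (induction p' rule: poly_mapping_single_induct)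
    case (single l d)
    then show ?case using linear_word_act[of l]
      by (simp add: mult_single rep_single word_act_plus linear_op_def smul_simps mult.commute)
  qed (simp add: distrib_left rep_add)
qed (simp add: distrib_right rep_add rep_linear)

lemma rep_fscalar: "rep (fscalar c) v = smul c v"
  by (simp add: fscalar_def rep_single zero_word_def)

lemma rep_1: "rep 1 v = v"
  using rep_fscalar[of 1] by (simp add: fscalar_1 smul_simps)

lemma rep_uminus: "rep (- p) v = - rep p v"
  using rep_linear(2)[of p "- 1" v] by (simp add: fscalar_uminus[of p] rep_mult rep_fscalar smul_simps)

lemma rep_diff: "rep (p - p') v = rep p v - rep p' v"
  using rep_add[of p "- p'" v] by (simp add: rep_uminus)

lemma rep_FX1: "rep FX1 = lower 2 coeff1"
  by (rule ext) (simp add: FX1_def fgen_def rep_single smul_simps)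

lemma rep_FX4: "rep FX4 = raise"
  by (rule ext) (simp add: FX4_def fgen_def rep_single smul_simps)

lemma rep_FX2: "rep (FX2 r) = lower 1 coeff2"
proof (rule ext, rule poly_mapping_eqI)
  fix v k
  have eq: "FX2 r = FX1 * FX4 - fscalar (r^2) * FX4 * FX1" by (simp add: FX2_def FX1_def FX4_def)
  have "lookup (rep (FX2 r) v) k = ((if k = 0 then 0 else coeff1 (k - 1)) - r^2 * coeff1 k) * lookup v (k + 1)"
    unfolding eq
    by (auto simp: rep_diff rep_mult rep_FX1 rep_FX4 rep_fscalar lookup_ops lookup_minus algebra_simps
        split: nat.splits)
  then show "lookup (rep (FX2 r) v) k = lookup (lower 1 coeff2 v) k"
    by (simp add: coeff_X2 lookup_ops)
qed

lemma rep_FX3: "rep (FX3 r s) = lower 0 coeff3"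
proof (rule ext, rule poly_mapping_eqI)
  fix v k
  have eq: "FX3 r s = FX4 * FX2 r - fscalar (1 / s^2) * FX2 r * FX4" by (simp add: FX3_def FX4_def)
  have "lookup (rep (FX3 r s) v) k = (coeff2 k - (if k = 0 then 0 else 1 / s^2 * coeff2 (k - 1))) * lookup v k"
    unfolding eq
    by (cases k) (simp_all add: rep_diff rep_mult rep_FX2 rep_FX4 rep_fscalar lookup_ops lookup_minus
        algebra_simps)
  then show "lookup (rep (FX3 r s) v) k = lookup (lower 0 coeff3 v) k"
    by (simp add: coeff_X3 lookup_ops)
qed

lemma rep_U_relations: "p \<in> U_relations r s \<Longrightarrow> rep p v = 0"
proof -
  assume p: "p \<in> U_relations r s"
  have 1: "rep (FX1 * FX2 r - fscalar (s^2) * FX2 r * FX1) v = 0"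
  proof (rule poly_mapping_eqI)
    fix k
    have "lookup (rep (FX1 * FX2 r - fscalar (s^2) * FX2 r * FX1) v) k =
        (coeff2 k * coeff1 (k + 1) - s^2 * (coeff1 k * coeff2 (k + 2))) * lookup v (k + 3)"
      by (simp add: rep_diff rep_mult rep_FX1 rep_FX2 rep_fscalar lookup_ops lookup_minus
          eval_nat_numeral algebra_simps)
    then show "lookup (rep (FX1 * FX2 r - fscalar (s^2) * FX2 r * FX1) v) k = lookup 0 k"
      using coeff_X1_X2[of k] by simp
  qed
  have 2: "rep (FX3 r s * FX4 - fscalar (r * s) * FX4 * FX3 r s) v = 0" for v
  proof (rule poly_mapping_eqI)
    fix k
    show "lookup (rep (FX3 r s * FX4 - fscalar (r * s) * FX4 * FX3 r s) v) k = lookup 0 k"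
    proof (cases k)
      case (Suc j)
      have "lookup (rep (FX3 r s * FX4 - fscalar (r * s) * FX4 * FX3 r s) v) k =
          (coeff3 j - r * s * coeff3 (j + 1)) * lookup v j"
        using Suc by (simp add: rep_diff rep_mult rep_FX3 rep_FX4 rep_fscalar lookup_ops lookup_minus
            algebra_simps)
      then show ?thesis by (simp add: coeff_X3_X4[of j])
    qed (simp add: rep_diff rep_mult rep_FX3 rep_FX4 rep_fscalar lookup_ops lookup_minus)
  qed
  \<comment> \<open>\<open>FX3_FX4_relation\<close> yields the second relation with a factor -1/s^2,
    which is cancelled by evaluating at -s^2 v.\<close>
  have 3: "rep p' v = 0" if "\<And>w. rep (fscalar (- 1 / s^2) * p') w = 0" for p'
    using that[of "smul (- (s^2)) v"] s0 by (simp add: rep_mult rep_fscalar smul_simps)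
  show ?thesis
    using p 1 3[OF 2[unfolded FX3_FX4_relation[OF s0]]]
    unfolding U_relations_def Let_def FX1_FX2_relation by auto
qed

text \<open>The annihilator of the model is a two-sided ideal of the free algebra and contains the
  relations.\<close>

lemma rep_U_ideal: "p \<in> U_ideal r s \<Longrightarrow> rep p v = 0"
proof -
  let ?I = "{p. \<forall>v. rep p v = 0}"
  have sub: "subgroup ?I (add_monoid free_ring)"
  proof -
    interpret ring free_ring by (rule ring_free_ring)
    have neg: "\<ominus>\<^bsub>free_ring\<^esub> x = - x" for x
      by (rule minus_equality) (simp_all add: free_ring_def)
    have "1 - 1 \<in> ?I" by (simp only: rep_diff mem_Collect_eq) simp
    then show ?thesis
      by (intro add.subgroupI) (auto simp: neg rep_uminus, auto simp: free_ring_def rep_add)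
  qed
  have "ideal ?I free_ring"
    by (rule idealI[OF ring_free_ring sub]) (simp_all add: free_ring_def rep_mult rep_linear)
  then have "U_ideal r s \<subseteq> ?I"
    unfolding U_ideal_def using rep_U_relations
    by (intro ring.genideal_minimal[OF ring_free_ring]) auto
  then show "p \<in> U_ideal r s \<Longrightarrow> rep p v = 0" by auto
qed

definition U_act :: "(nat \<Rightarrow>\<^sub>0 complex) \<Rightarrow> free_alg set \<Rightarrow> (nat \<Rightarrow>\<^sub>0 complex)" where
  "U_act v u = rep (SOME p. U_class r s p = u) v"

text \<open>Representatives of a class differ by an element of the ideal, which acts as
  zero.\<close>

lemma U_act: "U_act v (U_class r s p) = rep p v"
proof -
  have "U_class r s (SOME p'. U_class r s p' = U_class r s p) = U_class r s p"
    by (rule someI_ex) auto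
  then have "rep ((SOME p'. U_class r s p' = U_class r s p) - p) v = 0"
    by (simp add: U_class_eq_iff rep_U_ideal)
  then show ?thesis by (simp add: U_act_def rep_diff)
qed

section \<open>The model and its truncations as modules\<close>

definition V_mod :: "(free_alg set, nat \<Rightarrow>\<^sub>0 complex) rmod" where
  "V_mod = \<lparr>carrier = UNIV, monoid.mult = undefined, one = undefined, zero = 0, add = (+), ract = U_act\<rparr>"

lemma V_mod_simps: "carrier V_mod = UNIV" "zero V_mod = 0" "add V_mod = (+)" "ract V_mod = U_act"
  by (simp_all add: V_mod_def)

lemma right_module_V: "right_module (U r s) V_mod"
proof (intro right_module.intro right_module_axioms.intro)
  show "abelian_group V_mod" by (rule abelian_group_poly_mapping) (simp_all add: V_mod_simps)
qed (auto simp: V_mod_simps ring_U carrier_U U_act rep_add rep_mult rep_linear rep_1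
    simp flip: U_class_add U_class_mult U_class_one)

text \<open>For N = km, truncated vectors serve as representatives of the cosets in Q_{k,m}. The
  carrier is that of \<open>Mxi_mod\<close> when N = m, so these two can be compared by the identity
  map.\<close>

definition W_mod :: "nat \<Rightarrow> (free_alg set, nat \<Rightarrow>\<^sub>0 complex) rmod" where
  "W_mod N = vec_rmod N (\<lambda>v u. trunc N (U_act v u))"

lemma carrier_W: "carrier (W_mod N) = {v. trunc N v = v}"
  by (simp add: W_mod_def vec_rmod_simps trunc_eq_self_iff)

lemma W_mod_simps: "zero (W_mod N) = 0"
  "add (W_mod N) = (+)" "ract (W_mod N) = (\<lambda>v u. trunc N (U_act v u))"
  by (simp_all add: W_mod_def vec_rmod_simps)

text \<open>Of the generators only \<open>X1\<close> lowers indices, by 2. From N on it can enter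
  the range below N only at N - 2 or N - 1, and both weights contain 1 - q^N.\<close>

lemma rep_trunc_eq_0:
  assumes N: "q ^ N = 1" and v: "trunc N v = 0"
  shows "trunc N (rep p v) = 0"
  using v
proof (induction p arbitrary: v rule: poly_mapping_single_induct)
  case (single w c)
  obtain gs where w: "w = Word gs" by (cases w)
  have "trunc N (fold gen_act gs v) = 0"
    using single
  proof (induction gs arbitrary: v)
    case (Cons g gs)
    have "trunc N (gen_act g v) = 0"
    proof (cases g)
      case E1
      have "coeff1 k * lookup v (k + 2) = 0" if "k < N" for k
      proof (cases "k + 2 < N")
        case True
        then show ?thesis using Cons.prems by (simp add: trunc_eq_0_iff)
      next
        case False
        then have "k + 2 = N \<or> k + 1 = N" using that by arith
        then show ?thesis using N by (auto simp: coeff1_def)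
      qed
      then show ?thesis using E1 by (auto simp: trunc_eq_0_iff lookup_ops)
    next
      case E2
      then show ?thesis using Cons.prems by (auto simp: trunc_eq_0_iff lookup_ops split: nat.splits)
    qed
    then show ?case using Cons.IH by simp
  qed simp
  then show ?case by (simp add: w rep_single trunc_simps smul_simps)
qed (simp add: rep_add trunc_simps)

text \<open>The discarded tail stays a tail under the action, so truncating beforehand changes
  nothing. This makes the truncated action associative.\<close>

lemma trunc_rep_trunc:
  assumes "q ^ N = 1"
  shows "trunc N (rep p (trunc N v)) = trunc N (rep p v)"
proof -
  have "trunc N (rep p (v - trunc N v)) = 0"
    by (rule rep_trunc_eq_0[OF assms]) (simp add: trunc_simps)
  moreover have "rep p v = rep p (v - trunc N v) + rep p (trunc N v)"
    by (simp flip: rep_linear)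
  ultimately show ?thesis by (simp add: trunc_simps)
qed

lemma right_module_W:
  assumes N: "q ^ N = 1"
  shows "right_module (U r s) (W_mod N)"
proof (intro right_module.intro right_module_axioms.intro)
  show "abelian_group (W_mod N)"
  proof (rule abelian_group_poly_mapping)
    fix x assume "x \<in> carrier (W_mod N)"
    then show "- x \<in> carrier (W_mod N)" using trunc_simps(5)[of N 0 x] by (simp add: carrier_W trunc_simps)
  qed (auto simp: W_mod_simps carrier_W trunc_simps)
qed (auto simp: W_mod_simps carrier_W ring_U carrier_U U_act rep_add rep_mult rep_linear rep_1 trunc_simps
    trunc_rep_trunc[OF N] simp flip: U_class_add U_class_mult U_class_one)

section \<open>The induced module\<close>

lemma rep_FX4_power: "rep (FX4 ^ j) (single k c) = single (k + j) c"
  by (induction j arbitrary: k) (simp_all add: rep_1 rep_mult rep_FX4 raise_single)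

text \<open>On \<open>B\<close> this is the character by which it acts on the line through f(0);
  elsewhere it is only a matrix coefficient.\<close>

definition chi :: "free_alg \<Rightarrow> complex" where
  "chi p = lookup (rep p (single 0 1)) 0"

text \<open>\<open>X1\<close> and \<open>X2\<close> kill f(0), while \<open>X3\<close> multiplies it
  by \<open>lam\<close>; stability of the line passes to sums and products.\<close>

lemma rep_B_free:
  assumes "b \<in> B_free r s"
  shows "rep b (single 0 z) = single 0 (z * chi b)"
proof -
  have "\<exists>c. \<forall>z. rep b (single 0 z) = single 0 (z * c)"
    using assms
  proof induction
    case (scalar c)
    then show ?case by (intro exI[of _ c]) (simp add: rep_fscalar smul_simps mult.commute)
  next
    case (add p p')
    then obtain c d where "\<forall>z. rep p (single 0 z) = single 0 (z * c)" "\<forall>z. rep p' (single 0 z) = single 0 (z * d)"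
      by blast
    then show ?case by (intro exI[of _ "c + d"]) (simp add: rep_add distrib_left single_add)
  next
    case (mult p p')
    then obtain c d where "\<forall>z. rep p (single 0 z) = single 0 (z * c)" "\<forall>z. rep p' (single 0 z) = single 0 (z * d)"
      by blast
    then show ?case by (intro exI[of _ "c * d"]) (simp add: rep_mult mult.assoc)
  next
    case X3
    show ?case by (intro exI[of _ "coeff3 0"]) (simp add: rep_FX3 lower_single mult.commute)
  qed (auto simp: rep_FX1 rep_FX2 lower_single intro!: exI[of _ 0])
  then obtain c where "\<forall>z. rep b (single 0 z) = single 0 (z * c)" by blast
  then show ?thesis by (simp add: chi_def del: single_one)
qed

lemma chi_simps:
  "chi (fscalar c) = c" "chi FX1 = 0" "chi (FX2 r) = 0" "chi (FX3 r s) = lam" "chi (p + p') = chi p + chi p'"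
  by (simp_all add: chi_def rep_fscalar smul_simps rep_FX1 rep_FX2 rep_FX3 lower_single coeff3_def
      rep_add lookup_add del: single_one)

text \<open>\<open>b\<close> acts first and only rescales f(0), so the factor \<open>p\<close> after
  it may be any element of the free algebra.\<close>

lemma chi_mult:
  assumes "b \<in> B_free r s"
  shows "chi (b * p) = chi b * chi p"
proof -
  have "rep p (single 0 (chi b)) = smul (chi b) (rep p (single 0 1))"
    using rep_linear(2)[of p "chi b" "single 0 1"] by (simp add: smul_simps del: single_one)
  then show ?thesis
    unfolding chi_def[of "b * p"] chi_def[of p] rep_mult
    using rep_B_free[OF assms, of 1] by (simp add: smul.rep_eq del: single_one)
qed

definition B_act :: "complex \<Rightarrow> free_alg set \<Rightarrow> complex" where
  "B_act z u = z * lookup (U_act (single 0 1) u) 0"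

lemma B_act: "B_act z (U_class r s p) = z * chi p"
  by (simp add: B_act_def U_act chi_def)

lemma right_module_B_act: "right_module (U_B r s) (complex_rmod B_act)"
proof (intro right_module.intro right_module_axioms.intro)
  show "abelian_group (complex_rmod B_act)"
  proof (rule abelian_groupI)
    fix x assume "x \<in> carrier (complex_rmod B_act)"
    then show "\<exists>y\<in>carrier (complex_rmod B_act). y \<oplus>\<^bsub>complex_rmod B_act\<^esub> x = \<zero>\<^bsub>complex_rmod B_act\<^esub>"
      by (intro bexI[of _ "- x"]) (simp_all add: complex_rmod_simps)
  qed (simp_all add: complex_rmod_simps)
next
  fix x assume "x \<in> carrier (complex_rmod B_act)"
  show "x \<lhd>\<^bsub>complex_rmod B_act\<^esub> \<one>\<^bsub>U_B r s\<^esub> = x"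
    unfolding complex_rmod_simps U_B_simps fscalar_1[symmetric] U_class_one[symmetric] B_act chi_simps by simp
qed (auto simp: complex_rmod_simps U_B_simps carrier_U_B ring_U_B B_act chi_simps chi_mult algebra_simps
    simp flip: U_class_add U_class_mult)

text \<open>\<open>B_act\<close> satisfies the specification, so the chosen action does as well. The
  specification fixes the action on generators of \<open>B\<close>, and induction over
  \<open>B\<close> extends the agreement with \<open>chi\<close>.\<close>

lemma C_mod_act:
  assumes "b \<in> B_free r s"
  shows "z \<lhd>\<^bsub>C_mod r s lam\<^esub> U_class r s b = z * chi b"
proof -
  let ?P = "\<lambda>act. right_module (U_B r s) (complex_rmod act) \<and>
     (\<forall>z c. act z (U_scalar r s c) = c * z) \<and>
     act 1 (X1 r s) = 0 \<and> act 1 (X2 r s) = 0 \<and> act 1 (X3 r s) = lam"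
  define act where "act = (SOME act. ?P act)"
  have "?P B_act"
    by (simp add: right_module_B_act U_scalar_def X1_def X2_def X3_def B_act chi_simps)
  then have P: "?P act" unfolding act_def by (rule someI[of ?P])
  then interpret right_module "U_B r s" "complex_rmod act" by simp
  have inB: "U_class r s p \<in> carrier (U_B r s)" if "p \<in> B_free r s" for p
    using that by (simp add: carrier_U_B)
  have act_add: "act z (U_class r s (p + p')) = act z (U_class r s p) + act z (U_class r s p')"
    and act_mult: "act z (U_class r s (p * p')) = act (act z (U_class r s p)) (U_class r s p')"
    if "p \<in> B_free r s" "p' \<in> B_free r s" for p p' z
    using ract_add_right[of z "U_class r s p" "U_class r s p'"]
      ract_assoc[of z "U_class r s p" "U_class r s p'"] that inB
    by (simp_all add: complex_rmod_simps U_B_simps U_class_add U_class_mult)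
  have scal: "act z (U_class r s (fscalar c)) = c * z" for z c
    using P by (simp add: U_scalar_def)
  \<comment> \<open>The conditions on \<open>X1\<close>, \<open>X2\<close>, \<open>X3\<close>
    concern the vector 1. Centrality of the scalars carries them to z, which is 1 acted on by the
    scalar z.\<close>
  have lin: "act z (U_class r s p) = z * act 1 (U_class r s p)" if p: "p \<in> B_free r s" for z p
    using act_mult[OF B_free.scalar p, of 1 z] act_mult[OF p B_free.scalar, of 1 z]
    by (simp add: scal fscalar_commute)
  have "act 1 (U_class r s b) = chi b"
    using assms
  proof induction
    case (mult p p')
    then show ?case using lin[of p' "chi p"] by (simp add: act_mult chi_mult)
  qed (use P in \<open>simp_all add: scal chi_simps X1_def X2_def X3_def act_add\<close>)
  then have "act z (U_class r s b) = z * chi b" using lin[OF assms, of z] by simp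
  then show ?thesis by (simp add: C_mod_def act_def complex_rmod_simps)
qed

lemma C_mod_simps:
  "carrier (C_mod r s lam) = UNIV" "zero (C_mod r s lam) = 0" "add (C_mod r s lam) = (+)"
  by (simp_all add: C_mod_def complex_rmod_simps)

section \<open>The tensor product and its relations\<close>

abbreviation "FP \<equiv> free_pairs (U r s) (C_mod r s lam)"
abbreviation "TK \<equiv> tensor_kernel (U_B r s) (U r s) (C_mod r s lam)"

lemma FP_simps: "carrier FP = {p. Poly_Mapping.keys p \<subseteq> UNIV \<times> carrier (U r s)}"
  "zero FP = 0" "add FP = (+)"
  "ract FP = (\<lambda>p w. frag_extend (\<lambda>(x, u). frag_of (x, u \<otimes>\<^bsub>U r s\<^esub> w)) p)"
  by (simp_all add: free_pairs_def C_mod_simps)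

lemma abelian_group_FP: "abelian_group FP"
  by (rule abelian_group_poly_mapping) (auto simp: FP_simps dest: subsetD[OF keys_add])

lemma frag_of_FP: "frag_of (z, U_class r s p) \<in> carrier FP"
  by (simp add: FP_simps)

lemma FP_inv: "p \<in> carrier FP \<Longrightarrow> inv\<^bsub>add_monoid FP\<^esub> p = - p"
proof -
  interpret abelian_group FP by (rule abelian_group_FP)
  assume p: "p \<in> carrier FP"
  then have "- p \<in> carrier FP" by (simp add: FP_simps)
  then have "\<ominus>\<^bsub>FP\<^esub> p = - p" using p by (intro minus_equality) (auto simp: FP_simps)
  then show ?thesis by (simp add: a_inv_def)
qed

lemma FP_diff: "p \<in> carrier FP \<Longrightarrow> p' \<in> carrier FP \<Longrightarrow> p - p' \<in> carrier FP"
  using keys_diff[of p p'] by (auto simp: FP_simps)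

lemma FP_add: "p \<in> carrier FP \<Longrightarrow> p' \<in> carrier FP \<Longrightarrow> p + p' \<in> carrier FP"
  using keys_add[of p p'] by (auto simp: FP_simps)

lemma tensor_relations_FP: "tensor_relations (U_B r s) (U r s) (C_mod r s lam) \<subseteq> carrier FP"
proof -
  interpret ring "U r s" by (rule ring_U)
  have "carrier (U_B r s) \<subseteq> carrier (U r s)" by (auto simp: carrier_U_B)
  then show ?thesis
    unfolding tensor_relations_def by (auto intro!: FP_diff) (auto simp: FP_simps)
qed

lemma TK_FP: "TK \<subseteq> carrier FP" and TK_0: "0 \<in> TK"
  and TK_add: "\<And>p p'. p \<in> TK \<Longrightarrow> p' \<in> TK \<Longrightarrow> p + p' \<in> TK"
  and TK_uminus: "\<And>p. p \<in> TK \<Longrightarrow> - p \<in> TK"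
proof -
  interpret abelian_group FP by (rule abelian_group_FP)
  have sub: "subgroup TK (add_monoid FP)"
    unfolding tensor_kernel_def using tensor_relations_FP
    by (intro group.generate_is_subgroup a_group) simp
  show TK: "TK \<subseteq> carrier FP" using subgroup.subset[OF sub] by simp
  show "0 \<in> TK" using subgroup.one_closed[OF sub] by (simp add: FP_simps)
  show "p + p' \<in> TK" if "p \<in> TK" "p' \<in> TK" for p p'
    using subgroup.m_closed[OF sub that] by (simp add: FP_simps)
  show "- p \<in> TK" if "p \<in> TK" for p
    using subgroup.m_inv_closed[OF sub that] that TK by (subst FP_inv[symmetric]) auto
qed

lemma TK_diff: "p \<in> TK \<Longrightarrow> p' \<in> TK \<Longrightarrow> p - p' \<in> TK"
  using TK_add[OF _ TK_uminus] by simp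

lemma TK_sum: "(\<And>i. i \<in> A \<Longrightarrow> f i \<in> TK) \<Longrightarrow> sum f A \<in> TK"
  by (induction A rule: infinite_finite_induct) (simp_all add: TK_0 TK_add)

lemma TK_add_left:
  "frag_of (x + y, U_class r s p) - frag_of (x, U_class r s p) - frag_of (y, U_class r s p) \<in> TK"
proof -
  have "frag_of (x \<oplus>\<^bsub>C_mod r s lam\<^esub> y, U_class r s p) - frag_of (x, U_class r s p) - frag_of (y, U_class r s p)
      \<in> tensor_relations (U_B r s) (U r s) (C_mod r s lam)"
    unfolding tensor_relations_def using U_class_in[of r s p] C_mod_simps(1) by blast
  then show ?thesis unfolding tensor_kernel_def C_mod_simps by (rule generate.incl)
qed

lemma TK_add_right:
  "frag_of (x, U_class r s (p + p')) - frag_of (x, U_class r s p) - frag_of (x, U_class r s p') \<in> TK"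
proof -
  have "frag_of (x, U_class r s (p + p')) - frag_of (x, U_class r s p) - frag_of (x, U_class r s p')
      \<in> tensor_relations (U_B r s) (U r s) (C_mod r s lam)"
    unfolding tensor_relations_def U_class_add
    using U_class_in[of r s p] U_class_in[of r s p'] C_mod_simps(1) by blast
  then show ?thesis unfolding tensor_kernel_def by (rule generate.incl)
qed

lemma TK_balanced:
  assumes "b \<in> B_free r s"
  shows "frag_of (x * chi b, U_class r s p) - frag_of (x, U_class r s (b * p)) \<in> TK"
proof -
  have "U_class r s b \<in> carrier (U_B r s)" using assms by (simp add: carrier_U_B)
  then have "frag_of (x * chi b, U_class r s p) - frag_of (x, U_class r s (b * p))
      \<in> tensor_relations (U_B r s) (U r s) (C_mod r s lam)"
    unfolding tensor_relations_def U_class_mult C_mod_act[OF assms, symmetric]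
    using U_class_in[of r s p] C_mod_simps(1) by blast
  then show ?thesis unfolding tensor_kernel_def by (rule generate.incl)
qed

text \<open>Additivity for 0 = 0 + 0 makes minus this element a relation.\<close>

lemma TK_frag_of_0: "frag_of (0, U_class r s p) \<in> TK"
  using TK_uminus[OF TK_add_left[of 0 0 p]] by simp

text \<open>The additive map sending a pair (z, u) to z f(0) u. On the tensor product it becomes the
  isomorphism onto the model.\<close>

definition eval_pairs :: "(complex \<times> free_alg set \<Rightarrow>\<^sub>0 int) \<Rightarrow> (nat \<Rightarrow>\<^sub>0 complex)" where
  "eval_pairs p = (\<Sum>i\<in>Poly_Mapping.keys p. smul (of_int (lookup p i)) (smul (fst i) (U_act (single 0 1) (snd i))))"

lemma eval_pairs_add: "eval_pairs (p + p') = eval_pairs p + eval_pairs p'"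
  unfolding eval_pairs_def
  by (rule setsum_keys_plus_distrib) (simp_all add: smul_simps distrib_right)

lemma eval_pairs_0: "eval_pairs 0 = 0"
  by (simp add: eval_pairs_def)

lemma eval_pairs_uminus: "eval_pairs (- p) = - eval_pairs p"
  using eval_pairs_add[of p "- p"] by (simp add: eval_pairs_0 eq_neg_iff_add_eq_0 add.commute)

lemma eval_pairs_diff: "eval_pairs (p - p') = eval_pairs p - eval_pairs p'"
  using eval_pairs_add[of p "- p'"] by (simp add: eval_pairs_uminus)

lemma eval_pairs_frag_of: "eval_pairs (frag_of (z, U_class r s p)) = rep p (single 0 z)"
  using rep_linear(2)[of p z "single 0 1"]
  by (simp add: eval_pairs_def smul_simps U_act del: single_one)

lemma eval_pairs_TK:
  assumes "p \<in> TK"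
  shows "eval_pairs p = 0"
proof -
  have rel: "eval_pairs h = 0" if h: "h \<in> tensor_relations (U_B r s) (U r s) (C_mod r s lam)" for h
  proof -
    have 1: "eval_pairs (frag_of (x + y, U_class r s p) - frag_of (x, U_class r s p) - frag_of (y, U_class r s p)) = 0"
      for x y p
      by (simp add: eval_pairs_diff eval_pairs_frag_of single_add rep_linear)
    have 2: "eval_pairs (frag_of (x, U_class r s (p + p')) - frag_of (x, U_class r s p) - frag_of (x, U_class r s p')) = 0"
      for x p p'
      by (simp add: eval_pairs_diff eval_pairs_frag_of rep_add)
    \<comment> \<open>Balancedness holds because \<open>B\<close> acts on f(0) through
      \<open>chi\<close>.\<close>
    have 3: "eval_pairs (frag_of (x * chi b, U_class r s p) - frag_of (x, U_class r s (b * p))) = 0"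
      if "b \<in> B_free r s" for x b p
      using that by (simp add: eval_pairs_diff eval_pairs_frag_of rep_mult rep_B_free)
    consider (left) x y t where
        "h = frag_of (x + y, U_class r s t) - frag_of (x, U_class r s t) - frag_of (y, U_class r s t)"
      | (right) x t t' where
        "h = frag_of (x, U_class r s (t + t')) - frag_of (x, U_class r s t) - frag_of (x, U_class r s t')"
      | (bal) x b t where "b \<in> B_free r s"
        "h = frag_of (x * chi b, U_class r s t) - frag_of (x, U_class r s (b * t))"
      using h unfolding tensor_relations_def C_mod_simps carrier_U carrier_U_B
      by (elim UnE CollectE exE conjE rangeE imageE; clarify)
        (auto simp: C_mod_act simp flip: U_class_add U_class_mult)
    then show ?thesis using 1 2 3 by cases simp_all
  qed
  \<comment> \<open>The carrier condition is carried along, since \<open>FP_inv\<close> identifies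
    the group inverse in \<open>generate\<close> with negation on the carrier.\<close>
  have "eval_pairs p = 0 \<and> p \<in> carrier FP"
    using assms unfolding tensor_kernel_def
  proof (induction rule: generate.induct)
    case (incl h)
    then show ?case using tensor_relations_FP rel by blast
  next
    case (inv h)
    then show ?case using tensor_relations_FP
      by (auto simp: FP_inv rel eval_pairs_uminus subset_iff) (auto simp: FP_simps)
  next
    case (eng h1 h2)
    then have "eval_pairs (h1 + h2) = 0 \<and> h1 + h2 \<in> carrier FP"
      by (simp only: eval_pairs_add FP_add add_0_left simp_thms)
    then show ?case by (simp add: FP_simps(3))
  qed (auto simp: FP_simps eval_pairs_0)
  then show ?thesis ..
qed

text \<open>The candidate inverse of \<open>eval_pairs\<close>. A cutoff \<open>n\<close>
  independent of \<open>v\<close>, instead of the support of \<open>v\<close>, makes additivity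
  modulo the relations a termwise matter.\<close>

definition f_sum :: "nat \<Rightarrow> (nat \<Rightarrow>\<^sub>0 complex) \<Rightarrow> (complex \<times> free_alg set \<Rightarrow>\<^sub>0 int)" where
  "f_sum n v = (\<Sum>j<n. frag_of (lookup v j, U_class r s (FX4 ^ j)))"

lemma f_sum_add: "f_sum n (v + w) - f_sum n v - f_sum n w \<in> TK"
  unfolding f_sum_def sum_subtractf[symmetric] lookup_add
  by (intro TK_sum TK_add_left)

lemma f_sum_0: "f_sum n 0 \<in> TK"
  unfolding f_sum_def by (intro TK_sum) (simp add: TK_frag_of_0)

lemma f_sum_single:
  assumes "j < n"
  shows "frag_of (c, U_class r s (FX4 ^ j)) - f_sum n (single j c) \<in> TK"
proof -
  have "f_sum n (single j c) = frag_of (c, U_class r s (FX4 ^ j)) +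
      (\<Sum>i\<in>{..<n} - {j}. frag_of (lookup (single j c) i, U_class r s (FX4 ^ i)))"
    unfolding f_sum_def using assms by (subst sum.remove[of _ j]) auto
  moreover have "(\<Sum>i\<in>{..<n} - {j}. frag_of (lookup (single j c) i, U_class r s (FX4 ^ i))) \<in> TK"
    by (intro TK_sum) (auto simp: lookup_single TK_frag_of_0)
  ultimately show ?thesis by (simp add: TK_uminus)
qed

text \<open>Modulo the relations every element of the tensor product is a combination of the \<open>f(j)\<close>;
  since the \<open>f(j)\<close> have independent images, the kernel of \<^const>\<open>eval_pairs\<close> is no larger than
  the relations.\<close>

lemma f_sum_eval_pairs:
  assumes "p \<in> carrier FP"
  shows "\<forall>\<^sub>F n in sequentially. p - f_sum n (eval_pairs p) \<in> TK"
proof -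
  have frag: "\<forall>z. \<forall>\<^sub>F n in sequentially. frag_of (z, U_class r s t) - f_sum n (eval_pairs (frag_of (z, U_class r s t))) \<in> TK"
    for t
    using r0 s0
  proof (induction rule: U_span_induct)
    case (base b j)
    show ?case
    proof
      fix z
      show "\<forall>\<^sub>F n in sequentially. frag_of (z, U_class r s (b * FX4 ^ j)) -
          f_sum n (eval_pairs (frag_of (z, U_class r s (b * FX4 ^ j)))) \<in> TK"
        \<comment> \<open>The cutoff must lie beyond j to keep the only possibly nonzero term of
          \<open>f_sum\<close>.\<close>
        using eventually_gt_at_top[of j]
      proof eventually_elim
        case (elim n)
        have "eval_pairs (frag_of (z, U_class r s (b * FX4 ^ j))) = single j (z * chi b)"
          by (simp add: eval_pairs_frag_of rep_mult rep_B_free[OF base] rep_FX4_power)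
        \<comment> \<open>Balancedness turns the pair (z, b X4^j) into (z chi(b), X4^j), which is
          congruent to \<open>f_sum\<close> of its value.\<close>
        then show ?case
          using TK_diff[OF f_sum_single[OF elim] TK_balanced[OF base], of "z * chi b" z "FX4 ^ j"]
          by simp
      qed
    qed
  next
    case (add p p')
    show ?case
    proof
      fix z :: complex
      let ?X = "frag_of (z, U_class r s p)" and ?Y = "frag_of (z, U_class r s p')"
        and ?Z = "frag_of (z, U_class r s (p + p'))"
      have eq: "eval_pairs ?Z = eval_pairs ?X + eval_pairs ?Y"
        by (simp add: eval_pairs_frag_of rep_add)
      have "\<forall>\<^sub>F n in sequentially. ?X - f_sum n (eval_pairs ?X) \<in> TK"
        "\<forall>\<^sub>F n in sequentially. ?Y - f_sum n (eval_pairs ?Y) \<in> TK"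
        using add by blast+
      then show "\<forall>\<^sub>F n in sequentially. ?Z - f_sum n (eval_pairs ?Z) \<in> TK"
      proof eventually_elim
        case (elim n)
        have "(?Z - ?X - ?Y) + (?X - f_sum n (eval_pairs ?X)) + (?Y - f_sum n (eval_pairs ?Y))
            - (f_sum n (eval_pairs ?X + eval_pairs ?Y) - f_sum n (eval_pairs ?X) - f_sum n (eval_pairs ?Y)) \<in> TK"
          by (intro TK_diff[OF _ f_sum_add] TK_add TK_add_right elim)
        then show ?case unfolding eq by (simp add: algebra_simps)
      qed
    qed
  qed
  from assms have "Poly_Mapping.keys p \<subseteq> UNIV \<times> carrier (U r s)" by (simp add: FP_simps)
  then show ?thesis
  proof (induction rule: frag_induction)
    case zero
    then show ?case using TK_uminus[OF f_sum_0] by (simp add: eval_pairs_0)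
  next
    case (one x)
    then show ?case using frag by (auto simp: carrier_U)
  next
    case (diff a b)
    then show ?case
    proof eventually_elim
      case (elim n)
      have "(a - f_sum n (eval_pairs a)) - (b - f_sum n (eval_pairs b)) +
         (f_sum n ((eval_pairs a - eval_pairs b) + eval_pairs b) - f_sum n (eval_pairs a - eval_pairs b)
            - f_sum n (eval_pairs b)) \<in> TK"
        by (intro TK_add[OF _ f_sum_add] TK_diff elim)
      then show ?case by (simp add: eval_pairs_diff algebra_simps)
    qed
  qed
qed

text \<open>An element of value 0 is congruent to \<open>f_sum n 0\<close>, whose terms have first
  entry 0 and so lie in the kernel.\<close>

lemma TK_eq: "TK = {p \<in> carrier FP. eval_pairs p = 0}"
proof (intro equalityI subsetI)
  fix p assume p: "p \<in> {p \<in> carrier FP. eval_pairs p = 0}"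
  then have "\<forall>\<^sub>F n in sequentially. p - f_sum n 0 \<in> TK" using f_sum_eval_pairs[of p] by simp
  then obtain n where "p - f_sum n 0 \<in> TK" by (auto dest: eventually_happens)
  from TK_add[OF this f_sum_0[of n]] show "p \<in> TK" by simp
qed (use TK_FP eval_pairs_TK in auto)

lemma eval_pairs_surj: "\<exists>p\<in>carrier FP. eval_pairs p = v"
proof (induction v rule: poly_mapping_single_induct)
  case (single k c)
  show ?case
    by (rule bexI[of _ "frag_of (c, U_class r s (FX4 ^ k))", OF _ frag_of_FP])
      (simp add: eval_pairs_frag_of rep_FX4_power)
next
  case (add v w)
  then obtain p p' where "p \<in> carrier FP" "p' \<in> carrier FP" "eval_pairs p = v" "eval_pairs p' = w" by blast
  then show ?case using eval_pairs_add FP_add by blast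
qed

lemma FP_act_closed:
  assumes "p \<in> carrier FP" "w \<in> carrier (U r s)"
  shows "p \<lhd>\<^bsub>FP\<^esub> w \<in> carrier FP"
proof -
  interpret ring "U r s" by (rule ring_U)
  have "Poly_Mapping.keys (frag_extend (\<lambda>(x, u). frag_of (x, u \<otimes>\<^bsub>U r s\<^esub> w)) p) \<subseteq> UNIV \<times> carrier (U r s)"
    by (rule order_trans[OF keys_frag_extend]) (use assms in \<open>auto simp: FP_simps\<close>)
  then show ?thesis by (simp add: FP_simps)
qed

lemma eval_pairs_act:
  assumes "p \<in> carrier FP" "w \<in> carrier (U r s)"
  shows "eval_pairs (p \<lhd>\<^bsub>FP\<^esub> w) = U_act (eval_pairs p) w"
proof -
  obtain t where t: "w = U_class r s t" using assms(2) by (auto simp: carrier_U)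
  from assms(1) have "Poly_Mapping.keys p \<subseteq> UNIV \<times> carrier (U r s)" by (simp add: FP_simps)
  then have "eval_pairs (frag_extend (\<lambda>(x, u). frag_of (x, u \<otimes>\<^bsub>U r s\<^esub> w)) p) = rep t (eval_pairs p)"
  proof (induction rule: frag_induction)
    case (one x)
    then show ?case
      by (auto simp: carrier_U t eval_pairs_frag_of rep_mult simp flip: U_class_mult)
  next
    case (diff a b)
    have "rep t (v - v') = rep t v - rep t v'" for v v'
      using rep_linear(1)[of t "v - v'" v'] by simp
    then show ?case using diff by (simp add: frag_extend_diff eval_pairs_diff)
  qed (simp add: eval_pairs_0 rep_linear)
  then show ?thesis by (simp add: FP_simps t U_act)
qed

definition M_iso :: "(complex \<times> free_alg set \<Rightarrow>\<^sub>0 int) set \<Rightarrow> (nat \<Rightarrow>\<^sub>0 complex)" where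
  "M_iso X = the_elem (eval_pairs ` X)"

lemma M_iso: "rmod_iso (U r s) (M_mod r s lam) V_mod M_iso"
  and right_module_M: "right_module (U r s) (M_mod r s lam)"
  and M_iso_f_vec: "M_iso (f_vec r s lam k) = single k 1"
proof -
  have surj: "eval_pairs ` carrier FP = carrier V_mod"
    using eval_pairs_surj by (auto simp: V_mod_simps image_iff) metis
  have ker: "TK = {p \<in> carrier FP. eval_pairs p = \<zero>\<^bsub>V_mod\<^esub>}"
    by (simp add: TK_eq V_mod_simps)
  show "rmod_iso (U r s) (M_mod r s lam) V_mod M_iso"
    unfolding M_iso_def[abs_def] M_mod_def induced_rmod_def
    by (rule quot_rmod_iso(1)[OF abelian_group_FP FP_act_closed right_module_V _ _ surj ker])
      (simp_all add: V_mod_simps eval_pairs_act FP_simps(3) eval_pairs_add)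
  show "right_module (U r s) (M_mod r s lam)"
    unfolding M_mod_def induced_rmod_def
    by (rule quot_rmod_iso(2)[OF abelian_group_FP FP_act_closed right_module_V _ _ surj ker])
      (simp_all add: V_mod_simps eval_pairs_act FP_simps(3) eval_pairs_add)
  have "the_elem (eval_pairs ` (TK +>\<^bsub>FP\<^esub> frag_of (1, U_class r s (FX4 ^ k))))
      = eval_pairs (frag_of (1, U_class r s (FX4 ^ k)))"
    by (rule quot_rmod_iso(3)[OF abelian_group_FP FP_act_closed right_module_V _ _ surj ker])
      (simp_all add: V_mod_simps eval_pairs_act FP_simps(3) eval_pairs_add frag_of_FP)
  then show "M_iso (f_vec r s lam k) = single k 1"
    unfolding M_iso_def f_vec_def pure_tensor_def X4_def U_class_power[symmetric] eval_pairs_frag_of rep_FX4_power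
    by simp
qed

section \<open>The quotients of $M(\lambda)$\<close>

lemma lookup_rep_FX4_power: "lookup (rep (FX4 ^ n) v) k = (if k < n then 0 else lookup v (k - n))"
proof (induction n arbitrary: k)
  case (Suc n)
  then show ?case
    by (auto simp: power_Suc2 rep_mult rep_FX4 lookup_ops simp del: power_Suc split: nat.splits)
qed (simp add: rep_1)

lemma M_iso_minus:
  assumes "x \<in> carrier (M_mod r s lam)"
  shows "M_iso (\<ominus>\<^bsub>M_mod r s lam\<^esub> x) = - M_iso x"
proof -
  interpret M: right_module "U r s" "M_mod r s lam" by (rule right_module_M)
  have "M_iso (\<ominus>\<^bsub>M_mod r s lam\<^esub> x) + M_iso x = 0"
    using rmod_iso_add[OF M_iso, of "\<ominus>\<^bsub>M_mod r s lam\<^esub> x" x] assms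
      rmod_iso_zero[OF M_iso right_module_M right_module_V]
    by (simp add: M.M.l_neg V_mod_simps)
  then show ?thesis by (simp add: eq_neg_iff_add_eq_0)
qed

lemma f_vec_closed: "f_vec r s lam k \<in> carrier (M_mod r s lam)"
  unfolding M_mod_def induced_rmod_def f_vec_def pure_tensor_def X4_def U_class_power[symmetric]
  using frag_of_FP[of 1 "FX4 ^ k"] by (auto simp: quot_rmod_def A_RCOSETS_def')

text \<open>Translates the span into a condition on coordinates. For the converse inclusion, a
  vector vanishing below km is the shift of another one by km, and shifted monomials are
  generators.\<close>

lemma M_sub_eq:
  "M_sub r s lam k m = {x \<in> carrier (M_mod r s lam). trunc (k * m) (M_iso x) = 0}"
proof -
  interpret M: right_module "U r s" "M_mod r s lam" by (rule right_module_M)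
  let ?M = "M_mod r s lam" and ?N = "k * m"
  let ?A = "{x \<lhd>\<^bsub>?M\<^esub> U_scalar r s c | x c. x \<in> {f_vec r s lam (?N + i) | i. True}}"
  have iso0: "M_iso \<zero>\<^bsub>?M\<^esub> = 0"
    using rmod_iso_zero[OF M_iso right_module_M right_module_V] by (simp add: V_mod_simps)
  have iso_add: "M_iso (x \<oplus>\<^bsub>?M\<^esub> y) = M_iso x + M_iso y" if "x \<in> carrier ?M" "y \<in> carrier ?M" for x y
    using rmod_iso_add[OF M_iso that] by (simp add: V_mod_simps)
  have gen: "f_vec r s lam j \<lhd>\<^bsub>?M\<^esub> U_scalar r s c \<in> carrier ?M"
    "M_iso (f_vec r s lam j \<lhd>\<^bsub>?M\<^esub> U_scalar r s c) = single j c" for j c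
    using rmod_iso_act[OF M_iso f_vec_closed, of "U_scalar r s c" j] M.ract_closed[OF f_vec_closed, of "U_scalar r s c" j]
    by (simp_all add: U_scalar_def V_mod_simps M_iso_f_vec U_act rep_fscalar smul_simps)
  have A: "h \<in> carrier ?M \<and> trunc ?N (M_iso h) = 0" if "h \<in> ?A" for h
    using that gen by (auto simp: trunc_simps)
  show ?thesis
  proof (intro equalityI subsetI)
    fix x assume "x \<in> M_sub r s lam k m"
    then have "x \<in> generate (add_monoid ?M) ?A" by (simp add: M_sub_def cspan_def)
    then show "x \<in> {x \<in> carrier ?M. trunc ?N (M_iso x) = 0}"
    proof induction
      case (inv h)
      then show ?case using A[OF inv] M_iso_minus[of h] trunc_simps(5)[of ?N 0 "M_iso h"]
        by (simp add: trunc_simps flip: a_inv_def)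
    qed (use A in \<open>auto simp: iso0 iso_add trunc_simps\<close>)
  next
    fix x assume x: "x \<in> {x \<in> carrier ?M. trunc ?N (M_iso x) = 0}"
    have sub: "M_sub r s lam k m \<subseteq> carrier ?M"
      unfolding M_sub_def cspan_def using A by (intro M.M.add.generate_incl) auto
    have ex: "\<exists>x\<in>M_sub r s lam k m. M_iso x = rep (FX4 ^ ?N) v" for v
    proof (induction v rule: poly_mapping_single_induct)
      case (single j c)
      have "f_vec r s lam (?N + j) \<lhd>\<^bsub>?M\<^esub> U_scalar r s c \<in> M_sub r s lam k m"
        unfolding M_sub_def cspan_def by (rule generate.incl) blast
      then show ?case using gen(2) by (metis rep_FX4_power add.commute)
    next
      case (add v w)
      then obtain x y where *: "x \<in> M_sub r s lam k m" "y \<in> M_sub r s lam k m"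
        "M_iso x = rep (FX4 ^ ?N) v" "M_iso y = rep (FX4 ^ ?N) w" by blast
      then have "x \<oplus>\<^bsub>?M\<^esub> y \<in> M_sub r s lam k m"
        unfolding M_sub_def cspan_def using generate.eng[of x "add_monoid ?M" _ y] by simp
      then show ?case using * sub iso_add[of x y] by (intro bexI) (auto simp: rep_linear)
    qed
    \<comment> \<open>Lowering by N with weights 1 undoes X4^N on vectors vanishing below N.\<close>
    have "M_iso x = rep (FX4 ^ ?N) (lower ?N (\<lambda>_. 1) (M_iso x))"
      using x by (intro poly_mapping_eqI) (auto simp: lookup_rep_FX4_power lookup_ops trunc_eq_0_iff)
    then obtain y where y: "y \<in> M_sub r s lam k m" "M_iso y = M_iso x" using ex by metis
    then have "y = x" using x sub rmod_iso_inj[OF M_iso, of y x] by auto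
    with y show "x \<in> M_sub r s lam k m" by simp
  qed
qed

text \<open>No index lies below 0, so M_{0,m} is all of M(lam), and M_{k,m} is the kernel of
  truncation at km, which respects the action since q^(km) = 1.\<close>

lemma Q_mod_iso:
  assumes N: "q ^ (k * m) = 1"
  shows "rmod_isomorphic (U r s) (Q_mod r s lam k m) (W_mod (k * m))"
    and right_module_Q: "right_module (U r s) (Q_mod r s lam k m)"
proof -
  interpret M: right_module "U r s" "M_mod r s lam" by (rule right_module_M)
  let ?N = "k * m"
  have "M_sub r s lam 0 m = carrier (M_mod r s lam)"
    by (auto simp: M_sub_eq trunc_eq_0_iff)
  then have Q: "Q_mod r s lam k m = quot_rmod (M_mod r s lam) (M_sub r s lam k m)"
    by (simp add: Q_mod_def)
  let ?h = "\<lambda>x. trunc ?N (M_iso x)"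
  have "\<exists>x\<in>carrier (M_mod r s lam). v = M_iso x" for v
    using rmod_iso_bij[OF M_iso] by (auto simp: bij_betw_def V_mod_simps)
  then have surj: "?h ` carrier (M_mod r s lam) = carrier (W_mod ?N)"
    by (auto simp: carrier_W trunc_simps image_iff) metis
  have ker: "M_sub r s lam k m = {x \<in> carrier (M_mod r s lam). ?h x = \<zero>\<^bsub>W_mod ?N\<^esub>}"
    by (simp add: M_sub_eq W_mod_simps)
  have act: "?h (x \<lhd>\<^bsub>M_mod r s lam\<^esub> a) = ?h x \<lhd>\<^bsub>W_mod ?N\<^esub> a"
    if "x \<in> carrier (M_mod r s lam)" "a \<in> carrier (U r s)" for x a
    using that rmod_iso_act[OF M_iso that]
    by (auto simp: V_mod_simps W_mod_simps carrier_U U_act trunc_rep_trunc[OF N])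
  have add: "?h (x \<oplus>\<^bsub>M_mod r s lam\<^esub> y) = ?h x \<oplus>\<^bsub>W_mod ?N\<^esub> ?h y"
    if "x \<in> carrier (M_mod r s lam)" "y \<in> carrier (M_mod r s lam)" for x y
    using that rmod_iso_add[OF M_iso that] by (simp add: V_mod_simps W_mod_simps trunc_simps)
  note quot = quot_rmod_iso[OF M.M.abelian_group_axioms M.ract_closed right_module_W[OF N] add act surj ker]
  show "rmod_isomorphic (U r s) (Q_mod r s lam k m) (W_mod ?N)"
    unfolding Q rmod_isomorphic_iff using quot(1) by blast
  show "right_module (U r s) (Q_mod r s lam k m)"
    unfolding Q by (rule quot(2))
qed

section \<open>Submodules of the truncations\<close>

lemma rsubmodule_W_iff:
  assumes "q ^ N = 1"
  shows "rsubmodule H (U r s) (W_mod N) \<longleftrightarrow> (\<forall>v\<in>H. trunc N v = v) \<and> 0 \<in> H \<and> (\<forall>v\<in>H. \<forall>w\<in>H. v + w \<in> H) \<and>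
    (\<forall>v\<in>H. \<forall>p. trunc N (rep p v) \<in> H)"
  unfolding rsubmodule_iff[OF right_module_W[OF assms]]
  by (auto simp: W_mod_simps carrier_W carrier_U U_act)

text \<open>Submodules are defined as additive subgroups stable under \<open>U\<close>; they are
  subspaces because \<open>U\<close> contains the scalars.\<close>

lemma rsubmodule_W_smul:
  assumes N: "q ^ N = 1" and H: "rsubmodule H (U r s) (W_mod N)" and v: "v \<in> H"
  shows "smul c v \<in> H"
proof -
  have "trunc N (rep (fscalar c) v) \<in> H" "trunc N v = v"
    using H v by (auto simp: rsubmodule_W_iff[OF N])
  then show ?thesis by (simp add: rep_fscalar trunc_simps)
qed

lemma rsubmodule_W_top:
  assumes N: "q ^ N = 1" and H: "rsubmodule H (U r s) (W_mod N)" and ne: "H \<noteq> {0}"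
  shows "single (N - 1) 1 \<in> H"
proof -
  note H' = H[unfolded rsubmodule_W_iff[OF N]]
  obtain v where v: "v \<in> H" "v \<noteq> 0" using ne H' by blast
  then have vN: "trunc N v = v" using H' by blast
  obtain k where "lookup v k \<noteq> 0" using v by (auto simp: poly_mapping_eq_iff fun_eq_iff)
  define j where "j = (LEAST j. lookup v j \<noteq> 0)"
  have j: "lookup v j \<noteq> 0" unfolding j_def by (rule LeastI) fact
  have less: "lookup v i = 0" if "i < j" for i using that not_less_Least unfolding j_def by blast
  have jN: "j < N" by (rule trunc_fixed_less[OF vN j])
  \<comment> \<open>This power of \<open>X4\<close> carries the lowest term exactly to the last
    index and all others beyond it, where they are cut off.\<close>
  have "trunc N (rep (FX4 ^ (N - 1 - j)) v) = single (N - 1) (lookup v j)"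
  proof (rule poly_mapping_eqI)
    fix i
    have "lookup v (i - (N - 1 - j)) = 0" if "i < N - 1" "\<not> i < N - 1 - j"
      using that jN by (intro less) auto
    then show "lookup (trunc N (rep (FX4 ^ (N - 1 - j)) v)) i = lookup (single (N - 1) (lookup v j)) i"
      using jN by (auto simp: lookup_ops lookup_rep_FX4_power lookup_single when_def)
  qed
  then have "single (N - 1) (lookup v j) \<in> H" using H' v by metis
  then have "smul (1 / lookup v j) (single (N - 1) (lookup v j)) \<in> H"
    by (rule rsubmodule_W_smul[OF N H])
  then show ?thesis using j by (simp add: smul_simps)
qed

lemma carrier_W_nontrivial:
  assumes "N > 0"
  shows "carrier (W_mod N) \<noteq> {\<zero>\<^bsub>W_mod N\<^esub>}"
proof -
  have "single 0 1 \<in> carrier (W_mod N)" using assms by (simp add: carrier_W trunc_simps del: single_one)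
  then show ?thesis by (auto simp: W_mod_simps)
qed

lemma indecomposable_W:
  assumes N: "q ^ N = 1" "N > 0"
  shows "indecomposable_rmod (U r s) (W_mod N)"
  unfolding indecomposable_rmod_def
proof (intro conjI notI)
  assume "\<exists>H K. rsubmodule H (U r s) (W_mod N) \<and> rsubmodule K (U r s) (W_mod N) \<and>
           H \<noteq> {\<zero>\<^bsub>W_mod N\<^esub>} \<and> K \<noteq> {\<zero>\<^bsub>W_mod N\<^esub>} \<and>
           H \<inter> K = {\<zero>\<^bsub>W_mod N\<^esub>} \<and> H <+>\<^bsub>W_mod N\<^esub> K = carrier (W_mod N)"
  then obtain H K where HK: "rsubmodule H (U r s) (W_mod N)" "rsubmodule K (U r s) (W_mod N)"
    "H \<noteq> {0}" "K \<noteq> {0}" "H \<inter> K = {0}"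
    by (auto simp: W_mod_simps)
  then have "single (N - 1) 1 \<in> H \<inter> K" using rsubmodule_W_top[OF N(1)] by blast
  with HK show False by (metis lookup_single_eq lookup_zero singletonD zero_neq_one)
qed (use right_module_W[OF N(1)] carrier_W_nontrivial[OF N(2)] in auto)

end

section \<open>Truncation at multiples of the order m of q\<close>

locale verma_root = verma +
  fixes m :: nat
  assumes lam0: "lam \<noteq> 0" and m_pos: "m > 0" and q_m: "q ^ m = 1"
    and q_less: "\<And>j. 0 < j \<Longrightarrow> j < m \<Longrightarrow> q ^ j \<noteq> 1"
begin

lemma q_km: "q ^ (k * m) = 1"
  by (simp add: power_mult mult.commute[of k] q_m)

lemma simple_W: "simple_rmod (U r s) (W_mod m)"
  unfolding simple_rmod_def
proof (intro conjI allI impI)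
  fix H assume H: "rsubmodule H (U r s) (W_mod m)"
  note H' = H[unfolded rsubmodule_W_iff[OF q_m]]
  \<comment> \<open>Induction on the top index d of the vector, which \<open>X2\<close> lowers by
    one.\<close>
  have bottom: "\<exists>c. c \<noteq> 0 \<and> single 0 c \<in> H" if "v \<in> H" "lookup v d \<noteq> 0" "\<forall>j>d. lookup v j = 0" for v d
    using that
  proof (induction d arbitrary: v)
    case 0
    then have "v = single 0 (lookup v 0)"
      by (intro poly_mapping_eqI) (auto simp: lookup_single when_def)
    then show ?case using 0 by metis
  next
    case (Suc d)
    have "trunc m v = v" using H' Suc.prems by blast
    then have "Suc d < m" using Suc.prems(2) by (rule trunc_fixed_less)
    \<comment> \<open>The weight contains 1 - q^(d+1), and 0 < d + 1 < m.\<close>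
    then have "coeff2 d \<noteq> 0"
      using q_less[of "d + 1"] lam0 r0 s0 q_neq by (simp add: coeff2_def)
    moreover have w: "trunc m (rep (FX2 r) v) \<in> H" using H' Suc.prems by blast
    ultimately show ?case
      using \<open>Suc d < m\<close> Suc.prems by (intro Suc.IH[OF w]) (simp_all add: rep_FX2 lookup_ops)
  qed
  show "H = {\<zero>\<^bsub>W_mod m\<^esub>} \<or> H = carrier (W_mod m)"
  proof (cases "H = {0}")
    case False
    then obtain v where v: "v \<in> H" "v \<noteq> 0" using H' by blast
    define d where "d = Max (Poly_Mapping.keys v)"
    have "Poly_Mapping.keys v \<noteq> {}" using v by simp
    then have "d \<in> Poly_Mapping.keys v" "\<forall>j>d. j \<notin> Poly_Mapping.keys v"
      unfolding d_def by (auto dest: Max_ge[OF finite_keys])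
    then obtain c where c: "c \<noteq> 0" "single 0 c \<in> H"
      using bottom[OF v(1), of d] by (auto simp: in_keys_iff)
    have "single k z \<in> H" if "k < m" for k z
    proof -
      have "smul (z / c) (single 0 c) \<in> H" by (rule rsubmodule_W_smul[OF q_m H c(2)])
      then have "trunc m (rep (FX4 ^ k) (single 0 z)) \<in> H" using H' c by (simp add: smul_simps)
      then show ?thesis using that by (simp add: rep_FX4_power trunc_simps)
    qed
    then have "trunc m v \<in> H" for v
      using H' by (induction v rule: poly_mapping_single_induct) (simp_all add: trunc_simps)
    then have "carrier (W_mod m) \<subseteq> H" by (auto simp: carrier_W) metis
    moreover have "H \<subseteq> carrier (W_mod m)" using H' by (auto simp: carrier_W)
    ultimately show ?thesis by blast
  qed (simp add: W_mod_simps)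
qed (use right_module_W[OF q_m] carrier_W_nontrivial[OF m_pos] in auto)

lemma not_simple_W:
  assumes "k \<ge> 2"
  shows "\<not> simple_rmod (U r s) (W_mod (k * m))"
proof
  assume simple: "simple_rmod (U r s) (W_mod (k * m))"
  \<comment> \<open>Stable because q^m = 1 makes m, like km, an admissible place to cut. It contains
    f(m) but not f(0).\<close>
  let ?H = "{v. trunc (k * m) v = v \<and> trunc m v = 0}"
  have m: "m < k * m" using assms m_pos by simp
  have "rsubmodule ?H (U r s) (W_mod (k * m))"
    unfolding rsubmodule_W_iff[OF q_km]
    using m by (auto simp: trunc_simps trunc_min rep_trunc_eq_0[OF q_m])
  then have "?H = {0} \<or> ?H = carrier (W_mod (k * m))"
    using simple by (auto simp: simple_rmod_def W_mod_simps)
  moreover have "single m 1 \<in> ?H" using m by (simp add: trunc_simps)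
  moreover have "single m 1 \<noteq> (0 :: nat \<Rightarrow>\<^sub>0 complex)"
    by (metis lookup_single_eq lookup_zero zero_neq_one)
  moreover have "single 0 1 \<in> carrier (W_mod (k * m))" using m by (simp add: carrier_W trunc_simps del: single_one)
  moreover have "single 0 1 \<notin> ?H" using m_pos by (simp add: trunc_simps del: single_one) simp
  ultimately show False by blast
qed

text \<open>The truncated model satisfies the specification, so the chosen action does too.
  Conversely, the specification fixes the scalars and the letters e1 = X1, e2 = X4 on basis vectors;
  linearity and associativity do the rest.\<close>

lemma Mxi_act:
  assumes "trunc m v = v"
  shows "v \<lhd>\<^bsub>Mxi_mod r s m lam\<^esub> U_class r s p = trunc m (rep p v)"
proof -
  let ?e = "\<lambda>a. single a (1::complex)"
  let ?x1 = "\<lambda>a. if a \<ge> 2 then single (a - 2)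
      (- (1 / r^(2 * (a - 1))) * ((1 - q^(a - 1)) / (1 - q)) * ((1 - q^a) / (1 - q^2)) * lam) else 0"
  let ?x2 = "\<lambda>a. if a \<ge> 1 then single (a - 1) (1 / (r * s)^(a - 1) * ((1 - q^a) / (1 - q)) * lam) else 0"
  let ?P = "\<lambda>act. right_module (U r s) (vec_rmod m act) \<and>
       (\<forall>a<m. \<forall>z c. act (single a z) (U_scalar r s c) = single a (c * z)) \<and>
       (\<forall>a<m. act (?e a) (X1 r s) = ?x1 a) \<and>
       (\<forall>a<m. act (?e a) (X2 r s) = ?x2 a) \<and>
       (\<forall>a<m. act (?e a) (X3 r s) = single a (1 / (r * s)^a * lam)) \<and>
       (\<forall>a<m. act (?e a) (X4 r s) = (if Suc a < m then ?e (Suc a) else 0))"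
  have c1: "coeff1 (a - 2) = - (1 / r^(2 * (a - 1))) * ((1 - q^(a - 1)) / (1 - q)) * ((1 - q^a) / (1 - q^2)) * lam"
    if "2 \<le> a" for a
  proof -
    have a: "a - 2 + 1 = a - 1" "a - 2 + 2 = a" using that by auto
    have "- x / y * u * v = - (1 / y) * u * v * x" for x y u v :: complex
      by (simp add: divide_inverse)
    then show ?thesis unfolding coeff1_def a .
  qed
  have c2: "coeff2 (a - 1) = 1 / (r * s)^(a - 1) * ((1 - q^a) / (1 - q)) * lam" if "1 \<le> a" for a
    using that by (cases a) (simp_all add: coeff2_def)
  have W1: "trunc m (rep FX1 (?e a)) = ?x1 a" if "a < m" for a
    using that c1[of a] by (simp add: rep_FX1 lower_single trunc_simps)
  have W2: "trunc m (rep (FX2 r) (?e a)) = ?x2 a" if "a < m" for a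
    using that c2[of a] less_imp_diff_less[of a m 1] by (simp add: rep_FX2 lower_single trunc_simps)
  have W3: "trunc m (rep (FX3 r s) (?e a)) = single a (1 / (r * s)^a * lam)" if "a < m" for a
    using that by (simp add: rep_FX3 lower_single trunc_simps coeff3_def)
  have W4: "trunc m (rep FX4 (?e a)) = (if Suc a < m then ?e (Suc a) else 0)" for a
    by (simp add: rep_FX4 raise_single trunc_simps)
  have W: "?P (\<lambda>v u. trunc m (U_act v u))"
    unfolding U_scalar_def X1_def X2_def X3_def X4_def U_act
  proof (intro conjI allI impI W1 W2 W3 W4)
    show "right_module (U r s) (vec_rmod m (\<lambda>v u. trunc m (U_act v u)))"
      using right_module_W[OF q_m] by (simp only: W_mod_def)
  qed (simp_all add: rep_fscalar smul_simps trunc_simps)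
  define act where "act = (SOME act. ?P act)"
  have P: "?P act" unfolding act_def by (rule someI[of ?P, OF W])
  note P_scalar = P[THEN conjunct2, THEN conjunct1, rule_format, unfolded U_scalar_def]
    and P1 = P[THEN conjunct2, THEN conjunct2, THEN conjunct1, rule_format, unfolded X1_def]
    and P4 = P[THEN conjunct2, THEN conjunct2, THEN conjunct2, THEN conjunct2, THEN conjunct2,
      rule_format, unfolded X4_def]
  have "right_module (U r s) (vec_rmod m act)" using P by (rule conjunct1)
  then interpret right_module "U r s" "vec_rmod m act" .
  \<comment> \<open>Writing elements of the carrier as \<open>trunc m v\<close> lets the inductions
    below run over arbitrary \<open>v\<close>.\<close>
  have C: "trunc m v \<in> carrier (vec_rmod m act)" for v
    by (simp add: vec_rmod_simps trunc_simps flip: trunc_eq_self_iff)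
  have act_0: "act 0 (U_class r s p) = 0" for p
    using ract_add_left[of 0 0 "U_class r s p"] ract_closed[of 0 "U_class r s p"] by (simp add: vec_rmod_simps)
  have act_add: "act (trunc m v + trunc m w) (U_class r s p) = act (trunc m v) (U_class r s p) + act (trunc m w) (U_class r s p)"
    for v w p
    using ract_add_left[OF C C, of "U_class r s p" v w] by (simp add: vec_rmod_simps)
  have act_mult: "act (trunc m v) (U_class r s (p * p')) = act (act (trunc m v) (U_class r s p)) (U_class r s p')" for v p p'
    using ract_assoc[OF C, of "U_class r s p" "U_class r s p'" v] by (simp add: vec_rmod_simps U_class_mult)
  have act_add_right: "act (trunc m v) (U_class r s (p + p')) = act (trunc m v) (U_class r s p) + act (trunc m v) (U_class r s p')" for v p p'
    using ract_add_right[OF C, of "U_class r s p" "U_class r s p'" v] by (simp add: vec_rmod_simps U_class_add)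
  have scal1: "act (single a z) (U_class r s (fscalar c)) = single a (c * z)" if "a < m" for a z c
    using that by (rule P_scalar)
  have scal: "act (trunc m v) (U_class r s (fscalar c)) = smul c (trunc m v)" for v c
    by (induction v rule: poly_mapping_single_induct)
      (auto simp: trunc_simps act_add smul_simps act_0 scal1)
  \<comment> \<open>The conditions on the generators speak of e(a) alone. Multiples of e(a) are
    reached because scalars are central, sums by additivity.\<close>
  have ext: "act (trunc m v) (U_class r s p) = trunc m (rep p v)"
    if p: "\<And>a. a < m \<Longrightarrow> act (?e a) (U_class r s p) = trunc m (rep p (?e a))" for p v
  proof (induction v rule: poly_mapping_single_induct)
    case (single k c)
    show ?case
    proof (cases "k < m")
      case True
      have "act (single k c) (U_class r s p) = act (act (trunc m (?e k)) (U_class r s (fscalar c))) (U_class r s p)"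
        using True scal1[OF True, of 1 c] by (simp add: trunc_simps)
      also have "\<dots> = act (act (trunc m (?e k)) (U_class r s p)) (U_class r s (fscalar c))"
        unfolding act_mult[symmetric] by (simp add: fscalar_commute)
      also have "\<dots> = smul c (trunc m (rep p (?e k)))"
        using True p by (simp add: trunc_simps scal)
      also have "\<dots> = trunc m (rep p (smul c (?e k)))"
        by (simp only: rep_linear trunc_simps)
      finally show ?thesis using True by (simp add: trunc_simps smul_simps)
    next
      case False
      \<comment> \<open>Beyond the cut the basis vector truncates to zero, and its image does so
        because the tail is stable.\<close>
      have "trunc m (rep p (single k c)) = 0"
        by (rule rep_trunc_eq_0[OF q_m]) (use False in \<open>simp add: trunc_simps\<close>)
      then show ?thesis using False by (simp add: trunc_simps act_0)
    qed
  qed (simp add: trunc_simps act_add rep_linear)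
  have gen: "act (trunc m v) (U_class r s (fgen g)) = trunc m (rep (fgen g) v)" for v g
  proof (rule ext)
    fix a assume a: "a < m"
    show "act (?e a) (U_class r s (fgen g)) = trunc m (rep (fgen g) (?e a))"
      using P1[OF a] W1[OF a] P4[OF a] W4[of a] by (cases g) (simp_all only: FX1_def FX4_def)
  qed
  have "act (trunc m v) (U_class r s p) = trunc m (rep p v)" for v
  proof (induction p arbitrary: v rule: poly_mapping_single_induct)
    case (single w c)
    obtain gs where w: "w = Word gs" by (cases w)
    show ?case unfolding w
    proof (induction gs arbitrary: v)
      case Nil
      then show ?case using scal[of v c] rep_fscalar[of c v]
        by (simp add: fscalar_def zero_word_def trunc_simps)
    next
      case (Cons g gs)
      have eq: "single (Word (g # gs)) c = fgen g * single (Word gs) c"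
        by (simp add: fgen_def mult_single)
      \<comment> \<open>The letter g acts first and returns a truncated vector, to which the
        induction hypothesis applies.\<close>
      show ?case
        unfolding eq act_mult gen Cons.IH rep_mult ..
    qed
  qed (simp add: act_add_right rep_add trunc_simps)
  from this[of v] show ?thesis
    using assms unfolding Mxi_mod_def Let_def q_def[symmetric] act_def[symmetric] vec_rmod_simps by simp
qed

lemma Mxi_simps: "carrier (Mxi_mod r s m lam) = {v. trunc m v = v}"
  "zero (Mxi_mod r s m lam) = 0" "add (Mxi_mod r s m lam) = (+)"
  by (simp_all add: Mxi_mod_def Let_def vec_rmod_simps trunc_eq_self_iff)

text \<open>The two actions agree on the common carrier but may differ off it, hence the identity
  map rather than an equation between modules.\<close>

lemma Mxi_iso: "rmod_iso (U r s) (Mxi_mod r s m lam) (W_mod m) (\<lambda>v. v)"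
  unfolding rmod_iso_def bij_betw_def
  by (auto simp: Mxi_simps W_mod_simps carrier_W carrier_U U_act Mxi_act)

lemma right_module_Mxi: "right_module (U r s) (Mxi_mod r s m lam)"
  by (rule right_module_transport[OF right_module_W[OF q_m] Mxi_iso])
    (auto simp: Mxi_simps W_mod_simps trunc_simps carrier_U Mxi_act)

end

theorem theorem11p2:
  fixes r s lam :: complex and m :: nat
  assumes "r \<noteq> 0" and "s \<noteq> 0"
    and "\<exists>n>0. r ^ n = 1" and "\<exists>n>0. s ^ n = 1"
    and "r^2 \<noteq> s^2"
    and "lam \<noteq> 0"
    and "m = mult_ord (r * inverse s)"
  shows "simple_rmod (U r s) (Q_mod r s lam 1 m) \<and>
     simple_rmod (U r s) (Mxi_mod r s m lam) \<and>
     rmod_isomorphic (U r s) (Q_mod r s lam 1 m) (Mxi_mod r s m lam) \<and>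
     (\<forall>k\<ge>2. indecomposable_rmod (U r s) (Q_mod r s lam k m) \<and>
             \<not> simple_rmod (U r s) (Q_mod r s lam k m))"
proof -
  obtain a b where ab: "a > 0" "r ^ a = 1" "b > 0" "s ^ b = 1" using assms(3,4) by blast
  \<comment> \<open>A common exponent for r and s shows that q is a root of unity, so its order m is
    positive.\<close>
  have "(r * inverse s) ^ (a * b) = (r ^ a) ^ b * inverse ((s ^ b) ^ a)"
    by (simp add: power_mult_distrib power_inverse mult.commute flip: power_mult)
  also have "\<dots> = 1" by (simp add: ab)
  finally have root: "(r * inverse s) ^ (a * b) = 1" .
  interpret verma r s lam using assms by unfold_locales
  have "a * b > 0" using ab by simp
  note mo = mult_ord[OF this root, folded assms(7) q_def]
  interpret verma_root r s lam m using assms(6) mo by unfold_locales auto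
  show ?thesis
  proof (intro conjI allI impI)
    obtain h where h: "rmod_iso (U r s) (Q_mod r s lam 1 m) (W_mod m) h"
      using Q_mod_iso(1)[OF q_km, of 1] by (auto simp: rmod_isomorphic_iff)
    show "simple_rmod (U r s) (Q_mod r s lam 1 m)"
      by (rule simple_rmod_iso[OF h right_module_Q[OF q_km] simple_W])
    show "simple_rmod (U r s) (Mxi_mod r s m lam)"
      by (rule simple_rmod_iso[OF Mxi_iso right_module_Mxi simple_W])
    show "rmod_isomorphic (U r s) (Q_mod r s lam 1 m) (Mxi_mod r s m lam)"
      using rmod_iso_comp[OF h rmod_iso_sym[OF Mxi_iso right_module_Mxi]] by (auto simp: rmod_isomorphic_iff)
  next
    fix k :: nat assume k: "2 \<le> k"
    obtain h where h: "rmod_iso (U r s) (Q_mod r s lam k m) (W_mod (k * m)) h"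
      using Q_mod_iso(1)[OF q_km, of k] by (auto simp: rmod_isomorphic_iff)
    show "indecomposable_rmod (U r s) (Q_mod r s lam k m)"
      using k m_pos
      by (intro indecomposable_rmod_iso[OF h right_module_Q[OF q_km] indecomposable_W[OF q_km]]) simp
    show "\<not> simple_rmod (U r s) (Q_mod r s lam k m)"
      using not_simple_W[OF k] simple_rmod_iso[OF rmod_iso_sym[OF h right_module_Q[OF q_km]] right_module_W[OF q_km]]
      by blast
  qed
qed

end
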